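(* Let $\{x_i\}_{i\ge 1}$ and $c$ be real numbers with $x_i\ge 0$, $c\ge 0$, $x_ix_j\in[0,1)$ and $cx_i\in[0,1)$ for all $i,j\ge1$. Let $W=(w_{i,j}:i,j\ge 1)$ be a symmetric random array ($w_{i,j}=w_{j,i}$ for all $i,j\geq 1$) such that $(w_{i,j}:1\le i\le j)$ are independent, with $w_{i,j}\sim\mathrm{Geom}(x_ix_j)$ when $i\ne j$ and $w_{i,i}\sim\mathrm{Geom}(cx_i)$. For $m,n,k\ge 1$ let $G_k(m,n)=g_k(W[m,n])$ be the higher-rank last passage times, where $W[m,n]=(w_{i,j}:1\le i\le m,\ 1\le j\le n)$, and set $\lambda_1(m,n)=G_1(m,n)$, $\lambda_k(m,n)=G_k(m,n)-G_{k-1}(m,n)$ for $k\ge 2$, and $\lambda(m,n)=(\lambda_k(m,n):k\ge 1)$ (which is a partition). Set $\lambda(m,n)=\emptyset$ when $m=0$ or $n=0$. Fix any integers $M,N\ge 0$ and a down-right path $\gamma=(v_0,\dots,v_{M+N})$ from $v_0=(N,N)$ to $v_{M+N}=(M+N,0)$, with corresponding word $s_1s_2\cdots s_{M+N}$. Then for any partitions $\lambda^0,\dots,\lambda^{M+N}$, $$\mathbb{P}\big(\lambda(v_i)=\lambda^i\text{ for } i=0,\dots,M+N\big)=Z\cdot\tau_{\lambda^0}(c)\cdot\mathbf{1}\{\lambda^{M+N}=\emptyset\}\cdot\prod_{i=1}^{M+N}Q(\lambda^{i-1},\lambda^i),$$ where $\tau_\lambda(c)=c^{\lambda_1-\lambda_2+\lambda_3-\lambda_4+\cdots}$,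 $$Q(\lambda^{i-1},\lambda^i)=\begin{cases} s_{\lambda^{i-1}/\lambda^i}(x_t), & \text{if } v_{i-1}\in\mathbb{Z}\times\{t\}\text{ and } s_i=D,\\ s_{\lambda^i/\lambda^{i-1}}(x_t), & \text{if } v_{i-1}\in\{t-1\}\times\mathbb{Z}\text{ and } s_i=R,\end{cases}$$ and, with $Y_<(\gamma)=\{(a,b)\in Y(\gamma): b<a\}$, the normalization constant is $$Z=\prod_{i=1}^N(1-cx_i)\cdot\prod_{(a,b)\in Y_<(\gamma)}(1-x_ax_b).$$
   Context: $w\sim\mathrm{Geom}(q)$, $q\in[0,1)$, means $\mathbb{P}(w=k)=q^k(1-q)$ for $k\in\mathbb{Z}_{\ge0}$. Convention: $0^0=1$. Matrices: an $n\times m$ matrix $A=(a_{i,j}:1\le i\le m,\ 1\le j\le n)$ has columns indexed by $i$ (left to right) and rows indexed by $j$ (bottom to top); its entries sit at lattice points $(i,j)\in\mathbb{Z}^2$. Up-right path: a (possibly empty) sequence $\pi=(u_1,\dots,u_r)$ of vertices of $\mathbb{Z}^2$ with $u_i-u_{i-1}\in\{(0,1),(1,0)\}$. Put $A(\pi)=\sum_{v\in\pi}a_v$. For a matrix $A$ with non-negative entries: for $1\le k\le\min(m,n)$, $g_k(A)=\max[A(\pi_1)+\cdots+A(\pi_k)]$, the maximum being over $k$-tuples of pairwise disjoint up-right paths with $\pi_i$ connecting $(1,i)$ to $(m,n-k+i)$; for $k\ge\min(m,n)+1$, $g_k(A)=\sum_{i=1}^m\sum_{j=1}^n a_{i,j}$.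 (Equivalently, $g_k(A)=h_k(A)$, the maximum of $A(\chi_1)+\cdots+A(\chi_k)$ over $k$-tuples of pairwise disjoint north-east chains in $\{1,\dots,m\}\times\{1,\dots,n\}$, a north-east chain being a possibly empty sequence of points $((a_1,b_1),\dots,(a_r,b_r))$ with $a_{i-1}\le a_i$, $b_{i-1}\le b_i$, $(a_{i-1},b_{i-1})\ne(a_i,b_i)$.) Partition: a weakly decreasing sequence of non-negative integers $\lambda_1\ge\lambda_2\ge\cdots$ that is eventually zero; $\emptyset$ is the zero partition. Interlacing: $\lambda\succeq\mu$ means $\lambda_1\ge\mu_1\ge\lambda_2\ge\mu_2\ge\cdots$. Skew Schur polynomial in one variable: $s_{\lambda/\mu}(x)=\mathbf{1}\{\lambda\succeq\mu\}\cdot x^{\sum_{i\ge 1}(\lambda_i-\mu_i)}$. Down-right path: a sequence $\gamma=(v_0,\dots,v_r)$ of vertices of $\mathbb{Z}^2$ with $v_i-v_{i-1}\in\{(0,-1),(1,0)\}$. Its corresponding word $s_1\cdots s_r$ has $s_i=D$ if $v_i-v_{i-1}=(0,-1)$ and $s_i=R$ if $v_i-v_{i-1}=(1,0)$. Put $$Y(\gamma)=\{(i,j)\in\mathbb{Z}_{\ge1}^2:(i+d,j+d)\in\gamma\text{ for some integer } d\ge 0\}.$$ *)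

theory Defs
  imports "HOL-Probability.Probability"
begin

(* The library's geometric_pmf takes the success probability 1 - q. *)
definition Geom :: "real \<Rightarrow> nat pmf" where
  "Geom q = geometric_pmf (1 - q)"

lemma pmf_Geom:
  assumes "0 \<le> q" and "q < 1"
  shows "pmf (Geom q) k = q ^ k * (1 - q)"
  using assms by (simp add: Geom_def)

(* Pairs are (column, row), with columns counted from the left and rows from the bottom.
   All paths considered below have both endpoints in the non-negative quadrant and are monotone
   in each coordinate, hence stay in it; so vertices with natural number coordinates suffice. *)
type_synonym vertex = "nat \<times> nat"

definition up_right_path :: "vertex list \<Rightarrow> bool" where
  "up_right_path p \<longleftrightarrow>
     successively (\<lambda>u v. v = (fst u, snd u + 1) \<or> v = (fst u + 1, snd u)) p"

definition connects :: "vertex list \<Rightarrow> vertex \<Rightarrow> vertex \<Rightarrow> bool" where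
  "connects p u v \<longleftrightarrow> p \<noteq> [] \<and> hd p = u \<and> last p = v"

definition path_weight :: "(nat \<Rightarrow> nat \<Rightarrow> 'a::linordered_semidom) \<Rightarrow> vertex list \<Rightarrow> 'a" where
  "path_weight A p = (\<Sum>(i, j)\<leftarrow>p. A i j)"

(* Only the values at arguments in {1..k} of the function pi are relevant. *)
definition path_tuple :: "nat \<Rightarrow> nat \<Rightarrow> nat \<Rightarrow> (nat \<Rightarrow> vertex list) \<Rightarrow> bool" where
  "path_tuple m n k \<pi> \<longleftrightarrow>
     (\<forall>i\<in>{1..k}. up_right_path (\<pi> i) \<and> connects (\<pi> i) (1, i) (m, n - k + i)) \<and>
     (\<forall>i\<in>{1..k}. \<forall>j\<in>{1..k}. i \<noteq> j \<longrightarrow> set (\<pi> i) \<inter> set (\<pi> j) = {})"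

(* The matrix is A restricted to columns 1..m and rows 1..n. *)
definition last_passage ::
  "(nat \<Rightarrow> nat \<Rightarrow> 'a::linordered_semidom) \<Rightarrow> nat \<Rightarrow> nat \<Rightarrow> nat \<Rightarrow> 'a" where
  "last_passage A m n k =
     (if k \<le> min m n
      then Max {(\<Sum>i = 1..k. path_weight A (\<pi> i)) | \<pi>. path_tuple m n k \<pi>}
      else (\<Sum>i = 1..m. \<Sum>j = 1..n. A i j))"

(* Integer sequences (l k) for k >= 1; the value at index 0 is never used. *)
definition is_partition :: "(nat \<Rightarrow> int) \<Rightarrow> bool" where
  "is_partition l \<longleftrightarrow> (\<forall>k\<ge>1. 0 \<le> l k \<and> l (k + 1) \<le> l k) \<and> (\<exists>K. \<forall>k\<ge>K. l k = 0)"

definition lpp_shape :: "(nat \<Rightarrow> nat \<Rightarrow> nat) \<Rightarrow> vertex \<Rightarrow> nat \<Rightarrow> int" where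
  "lpp_shape A = (\<lambda>(m, n) k.
     if m = 0 \<or> n = 0 then 0
     else if k = 1 then int (last_passage A m n 1)
     else int (last_passage A m n k) - int (last_passage A m n (k - 1)))"

definition interlaces :: "(nat \<Rightarrow> int) \<Rightarrow> (nat \<Rightarrow> int) \<Rightarrow> bool" where
  "interlaces l \<mu> \<longleftrightarrow> (\<forall>k\<ge>1. l k \<ge> \<mu> k \<and> \<mu> k \<ge> l (k + 1))"

(* For partitions the index sets of the following two sums are finite, and the exponents are
   non-negative (in the first case when the partitions interlace), so nat does not truncate. *)
definition skew_schur :: "(nat \<Rightarrow> int) \<Rightarrow> (nat \<Rightarrow> int) \<Rightarrow> real \<Rightarrow> real" where
  "skew_schur l \<mu> x =
     (if interlaces l \<mu> then x ^ nat (\<Sum>k \<in> {k. k \<ge> 1 \<and> l k \<noteq> \<mu> k}. l k - \<mu> k) else 0)"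

definition tau :: "(nat \<Rightarrow> int) \<Rightarrow> real \<Rightarrow> real" where
  "tau l c = c ^ nat (\<Sum>k \<in> {k. k \<ge> 1 \<and> l k \<noteq> 0}. (- 1) ^ (k + 1) * l k)"

definition down_right_path :: "vertex list \<Rightarrow> bool" where
  "down_right_path \<gamma> \<longleftrightarrow>
     successively (\<lambda>u v. (fst v = fst u \<and> snd v + 1 = snd u) \<or> v = (fst u + 1, snd u)) \<gamma>"

datatype letter = StepD | StepR

(* The letter s_i is at list position i - 1. *)
definition path_word :: "vertex list \<Rightarrow> letter list" where
  "path_word \<gamma> = map2 (\<lambda>u v. if fst v = fst u \<and> snd v + 1 = snd u then StepD else StepR) \<gamma> (tl \<gamma>)"

(* u is the initial vertex of the step: t = snd u for a down step, t - 1 = fst u for a right step. *)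
definition Q_weight ::
  "(nat \<Rightarrow> real) \<Rightarrow> vertex \<Rightarrow> letter \<Rightarrow> (nat \<Rightarrow> int) \<Rightarrow> (nat \<Rightarrow> int) \<Rightarrow> real" where
  "Q_weight x u s l \<mu> =
     (case s of
        StepD \<Rightarrow> skew_schur l \<mu> (x (snd u))
      | StepR \<Rightarrow> skew_schur \<mu> l (x (fst u + 1)))"

definition Y_set :: "vertex list \<Rightarrow> vertex set" where
  "Y_set \<gamma> = {(i, j). i \<ge> 1 \<and> j \<ge> 1 \<and> (\<exists>d. (i + d, j + d) \<in> set \<gamma>)}"

definition Y_less :: "vertex list \<Rightarrow> vertex set" where
  "Y_less \<gamma> = {(a, b) \<in> Y_set \<gamma>. b < a}"

definition norm_const :: "(nat \<Rightarrow> real) \<Rightarrow> real \<Rightarrow> nat \<Rightarrow> vertex list \<Rightarrow> real" where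
  "norm_const x c N \<gamma> =
     (\<Prod>i = 1..N. 1 - c * x i) * (\<Prod>(a, b) \<in> Y_less \<gamma>. 1 - x a * x b)"

end

theory Submission
  imports Defs
begin

text \<open>
  The last passage partitions of a box obey a local growth rule. If d, a, b, l are the
  partitions at (m,n), (m,n+1), (m+1,n), (m+1,n+1), and w is the entry at (m+1,n+1), then
  l_1 = max(a_1,b_1) + w and l_k = max(a_k,b_k) + min(a_{k-1},b_{k-1}) - d_{k-1} for
  k \<ge> 2. For fixed a and b this is a bijection between the pairs (d,w) with w \<ge> 0 and d
  interlaced below a and b, and the partitions l interlaced above them; moreover |l| + |d| = |a| + |b| + w.
  Hence moving a corner of the down-right path across one box trades the partition at the corner for a
  smaller one and an independent geometric variable, and by the identity for the sizes the product of
  skew Schur weights changes exactly by the weight of that variable. At the diagonal, symmetry gives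
  a = b, and the alternating sum l_1 - l_2 + ... exceeds that of d by w, which accounts for
  \<tau>. Flipping corners until the path runs along the axis shows that prescribing the partitions
  along the path either is impossible or fixes every entry of the array below the path
  (\<open>staircase_bijection\<close>); the probability is then a finite product of geometric weights.
  
  The harder half is that the partitions given by non-intersecting paths do obey the growth rule
  (\<open>lpp_shape_eq_shape\<close>). Record k disjoint paths by the columns in which they
  jump from one row to the next. In terms of the prefix sums U_r of the rows, the total weight is a
  constant plus the sum of U_r(z) - U_{r+1}(z-1) over all jumps, where z is the column of the jump
  out of row r (\<open>jump_weight\<close>). When the other jumps are held fixed, the jumps between
  rows j and j+1 range over intervals independently of each other. The Pitman transform
  replaces rows (U,V) by (U - \<mu>, V + \<mu>) with \<mu> the running maximum of
  U(z) - V(z-1). It changes the best jump in an interval by a boundary term only, and the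
  boundary terms cancel against the changes of the jumps out of rows j-1 and j+1
  (\<open>antidiagonal_balance\<close>). So the maximal weight is invariant (\<open>pitman_transform\<close>).
  One step of the growth rule is one Pitman transform; performing all of them turns row r of an
  n-row array into the part number n+1-r of the partition. In such sorted rows no jump gains
  anything, by interlacing, and the paths that jump as early as possible lose nothing, so the maximum
  is the sum of the k largest parts.
\<close>

section \<open>The growth rule\<close>

text \<open>
  Parts are numbered from 0, so that equality of partitions is equality of functions.
\<close>

definition grow :: "(nat \<Rightarrow> int) \<Rightarrow> (nat \<Rightarrow> int) \<Rightarrow> (nat \<Rightarrow> int) \<Rightarrow> int \<Rightarrow> nat \<Rightarrow> int" where
  "grow a b d w k =
     (case k of 0 \<Rightarrow> max (a 0) (b 0) + w
      | Suc i \<Rightarrow> max (a (Suc i)) (b (Suc i)) + min (a i) (b i) - d i)"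

lemma grow_0 [simp]: "grow a b d w 0 = max (a 0) (b 0) + w"
  and grow_Suc [simp]: "grow a b d w (Suc i) = max (a (Suc i)) (b (Suc i)) + min (a i) (b i) - d i"
  by (simp_all add: grow_def)

fun shape :: "(nat \<Rightarrow> nat \<Rightarrow> nat) \<Rightarrow> nat \<Rightarrow> nat \<Rightarrow> nat \<Rightarrow> int" where
  "shape A 0 n = (\<lambda>_. 0)"
| "shape A (Suc m) 0 = (\<lambda>_. 0)"
| "shape A (Suc m) (Suc n) =
     grow (shape A m (Suc n)) (shape A (Suc m) n) (shape A m n) (int (A (Suc m) (Suc n)))"

lemma shape_0_right [simp]: "shape A m 0 = (\<lambda>_. 0)"
  by (cases m) simp_all

definition interlaced :: "(nat \<Rightarrow> int) \<Rightarrow> (nat \<Rightarrow> int) \<Rightarrow> bool" where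
  "interlaced p q \<longleftrightarrow> (\<forall>k. q k \<le> p k \<and> p (Suc k) \<le> q k)"

lemma grow_interlaced:
  assumes "interlaced a d" "interlaced b d" "0 \<le> w"
  shows "interlaced (grow a b d w) a" "interlaced (grow a b d w) b"
proof -
  have *: "max (a k) (b k) \<le> grow a b d w k \<and> grow a b d w (Suc k) \<le> min (a k) (b k)" for k
  proof -
    have "a (Suc k) \<le> d k" "b (Suc k) \<le> d k" using assms by (auto simp: interlaced_def)
    moreover have "max (a k) (b k) \<le> grow a b d w k"
    proof (cases k)
      case (Suc i)
      have "d i \<le> a i" "d i \<le> b i" using assms by (auto simp: interlaced_def)
      then show ?thesis using Suc by (simp add: max_def min_def)
    qed (use assms in simp)
    ultimately show ?thesis by (auto simp: max_def min_def)
  qed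
  show "interlaced (grow a b d w) a" "interlaced (grow a b d w) b"
    unfolding interlaced_def using * by (meson max.bounded_iff min.bounded_iff)+
qed

lemma shape_interlaced:
  "interlaced (shape A (Suc m) n) (shape A m n) \<and> interlaced (shape A m (Suc n)) (shape A m n)"
proof (induction "m + n" arbitrary: m n rule: less_induct)
  case less
  have z: "interlaced (\<lambda>_. 0) (\<lambda>_. 0)" by (simp add: interlaced_def)
  have "interlaced (shape A (Suc m) n) (shape A m n)"
  proof (cases n)
    case (Suc n')
    then show ?thesis
      using grow_interlaced(1)[of "shape A m (Suc n')" "shape A m n'" "shape A (Suc m) n'"] less[of m n'] by simp
  qed (simp add: z)
  moreover have "interlaced (shape A m (Suc n)) (shape A m n)"
  proof (cases m)
    case (Suc m')
    then show ?thesis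
      using grow_interlaced(2)[of "shape A m' (Suc n)" "shape A m' n" "shape A (Suc m') n"] less[of m' n] by simp
  qed (simp add: z)
  ultimately show ?case ..
qed

lemma shape_nonneg: "0 \<le> shape A m n k"
proof (induction m)
  case (Suc m)
  then show ?case using shape_interlaced[of A m n] unfolding interlaced_def by (meson order_trans)
qed simp

lemma shape_antimono: "shape A m n (Suc k) \<le> shape A m n k"
proof (cases m)
  case (Suc m')
  then show ?thesis using shape_interlaced[of A m' n] unfolding interlaced_def by (meson order_trans)
qed simp

lemma shape_vanishes: "min m n \<le> k \<Longrightarrow> shape A m n k = 0"
proof (induction m n arbitrary: k rule: shape.induct[of _ A])
  case (3 A m n)
  then obtain i where k: "k = Suc i" by (cases k) auto
  have "shape A m (Suc n) (Suc i) = 0" "shape A (Suc m) n (Suc i) = 0" "shape A m n i = 0"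
    using 3 k by auto
  moreover have "shape A m (Suc n) i = 0 \<or> shape A (Suc m) n i = 0" using 3 k
    by (cases "m \<le> i") auto
  moreover have "0 \<le> shape A m (Suc n) i" "0 \<le> shape A (Suc m) n i" by (rule shape_nonneg)+
  ultimately show ?case by (auto simp: k)
qed auto

text \<open>
  max + min is the sum, so the parts telescope; the last summand disappears once K is beyond
  the length of a and b.
\<close>

lemma sum_grow:
  "(\<Sum>k<Suc K. grow a b d w k) = w + (\<Sum>k<K. a k + b k - d k) + max (a K) (b K)"
proof (induction K)
  case (Suc K)
  have "max (a K) (b K) + min (a K) (b K) = a K + b K" by (simp add: max_def min_def)
  then show ?case by (subst sum.lessThan_Suc, subst Suc.IH) simp
qed simp

lemma sum_shape:
  assumes "m \<le> K" "n \<le> K"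
  shows "(\<Sum>k<K. shape A m n k) = (\<Sum>i = 1..m. \<Sum>j = 1..n. int (A i j))"
  using assms
proof (induction m n arbitrary: K rule: shape.induct[of _ A])
  case (3 A m n)
  define F where "F m n = (\<Sum>i = 1..m. \<Sum>j = 1..n. int (A i j))" for m n
  obtain L where K: "K = Suc L" using "3.prems" by (cases K) auto
  have v: "shape A m (Suc n) L = 0" "shape A (Suc m) n L = 0" "shape A m n L = 0"
    using 3 K by (auto intro!: shape_vanishes)
  have s: "(\<Sum>k<L. shape A p q k) = (\<Sum>k<K. shape A p q k)" if "shape A p q L = 0" for p q
    using that K by simp
  have "(\<Sum>k<K. shape A (Suc m) (Suc n) k) = int (A (Suc m) (Suc n))
      + (F m (Suc n) + F (Suc m) n - F m n)"
  proof -
    have "(\<Sum>k<K. shape A (Suc m) (Suc n) k) = int (A (Suc m) (Suc n))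
      + (\<Sum>k<L. shape A m (Suc n) k + shape A (Suc m) n k - shape A m n k)"
      unfolding K shape.simps sum_grow by (simp add: v)
    then show ?thesis
      using 3 by (simp add: v sum.distrib sum_subtractf s F_def)
  qed
  also have "\<dots> = F (Suc m) (Suc n)" by (simp add: F_def sum.distrib)
  finally show ?case by (simp add: F_def)
qed auto

section \<open>Non-intersecting paths as arrays of jumps\<close>

text \<open>
  c i l is the column in which the i-th of k paths jumps from row i+l-1 to row i+l, where
  1 \<le> l \<le> p and there are k + p rows. The values at l = 0 and l = p+1 are the endpoints of the
  paths; the values at i = 0 and i = k+1 are sentinels to the right of and to the left of the box, so
  that every jump has four neighbours. Disjointness of neighbouring paths is the strict
  inequality: in a common row, path i+1 ends before path i enters.
\<close>

definition jump_array :: "nat \<Rightarrow> nat \<Rightarrow> nat \<Rightarrow> (nat \<Rightarrow> nat \<Rightarrow> nat) \<Rightarrow> bool" where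
  "jump_array k p m c \<longleftrightarrow>
     (\<forall>i\<in>{1..k}. c i 0 = 1 \<and> c i (Suc p) = m \<and> (\<forall>l\<le>p. c i l \<le> c i (Suc l))) \<and>
     (\<forall>l\<in>{1..p}. c 0 l = Suc m \<and> c (Suc k) l = 0 \<and> (\<forall>i\<le>k. c (Suc i) l < c i l))"

text \<open>
  The weight of the paths in terms of the prefix sums U_r of the rows. A path covers
  U_r(z') - U_r(z-1) in row r, where it enters at z and leaves at z'; the terms are collected by
  jumps, not by rows.
\<close>

definition jump_weight ::
  "(nat \<Rightarrow> nat \<Rightarrow> int) \<Rightarrow> nat \<Rightarrow> nat \<Rightarrow> nat \<Rightarrow> (nat \<Rightarrow> nat \<Rightarrow> nat) \<Rightarrow> int" where
  "jump_weight U k p m c =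
     (\<Sum>i = 1..k. U (p + i) m) +
     (\<Sum>i = 1..k. \<Sum>l = 1..p. U (i + l - 1) (c i l) - U (i + l) (c i l - 1))"

lemma sum_antidiagonal:
  fixes p q i :: nat and F :: "nat \<Rightarrow> int"
  shows "(\<Sum>l = 1..p. if l + i = q then F l else 0) = (if i < q \<and> q \<le> p + i then F (q - i) else 0)"
proof -
  have "(\<Sum>l = 1..p. if l + i = q then F l else 0) = (\<Sum>l = 1..p. if l = q - i then (if i < q then F l else 0) else 0)"
  proof (intro sum.cong refl)
    fix l assume "l \<in> {1..p}"
    then have *: "(l + i = q) = (l = q - i \<and> i < q)" by arith
    show "(if l + i = q then F l else 0) = (if l = q - i then (if i < q then F l else 0) else 0)"
      unfolding * by (rule if_if_eq_conj[symmetric])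
  qed
  also have "\<dots> = (if i < q \<and> q \<le> p + i then F (q - i) else 0)"
    by (subst sum.delta) (auto simp: Suc_le_eq)
  finally show ?thesis .
qed

lemma jump_array_le:
  assumes "jump_array k p m c" "1 \<le> i" "i \<le> k" "l \<le> Suc p"
  shows "c i l \<le> m" and "1 \<le> c i l"
proof -
  have mono: "\<forall>l\<le>p. c i l \<le> c i (Suc l)" and ends: "c i 0 = 1" "c i (Suc p) = m"
    using assms unfolding jump_array_def by auto
  show "c i l \<le> m"
    using assms(4) by (induction rule: inc_induct) (use mono ends in \<open>auto simp: less_Suc_eq_le intro: order_trans\<close>)
  show "1 \<le> c i l"
    using assms(4) by (induction l) (use mono ends in \<open>auto intro: order_trans\<close>)
qed

section \<open>Exchanging two adjacent rows\<close>

text \<open>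
  The jumps from row j to row j+1 form the antidiagonal i + l = j + 1. Keeping all other jumps, the
  jump (i,l) ranges over the columns between the maximum of its two lower neighbours and
  the minimum of its two upper ones. Two consecutive jumps of the antidiagonal share two
  neighbours, the minimum bounding one of them and the maximum the other, and
  \<mu>(min) + \<mu>(max) is the sum of \<mu> over both; so the sum over the interval ends equals the sum over the
  adjacent antidiagonals. At the boundary of the array the sentinel is never the binding neighbour, or
  it contributes \<mu>(0) = 0; the exception is the jump (1,p) bounded by the end column m.
\<close>

lemma antidiagonal_balance:
  fixes \<mu> :: "nat \<Rightarrow> int"
  assumes c: "jump_array k p m c" and "\<mu> 0 = 0" "1 \<le> j" "j < k + p" "1 \<le> k"
  shows "(\<Sum>i = 1..k. if i < Suc j \<and> Suc j \<le> p + i then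
             \<mu> (min (c i (Suc (Suc j - i))) (c (i - 1) (Suc j - i) - 1))
           + \<mu> (max (c i (Suc j - i - 1) - 1) (c (Suc i) (Suc j - i))) else 0)
       = (\<Sum>i = 1..k. if i < j \<and> j \<le> p + i then \<mu> (c i (j - i) - 1) else 0)
       + (\<Sum>i = 1..k. if i < Suc (Suc j) \<and> Suc (Suc j) \<le> p + i then \<mu> (c i (Suc (Suc j) - i)) else 0)
       + (if j = p then \<mu> m else 0)"
proof -
  define X where "X i \<longleftrightarrow> i \<le> j \<and> j < p + i" for i
  define X' where "X' i \<longleftrightarrow> i \<le> Suc j \<and> Suc j < p + i" for i
  define lo where "lo i = \<mu> (min (c i (Suc (Suc j) - i)) (c (i - 1) (Suc j - i) - 1))" for i
  define hi where "hi i = \<mu> (max (c i (Suc (Suc j) - i)) (c (i - 1) (Suc j - i) - 1))" for i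
  define up where "up i = \<mu> (c i (Suc (Suc j) - i))" for i
  define dn where "dn i = \<mu> (c (i - 1) (Suc j - i) - 1)" for i
  have low: "(\<Sum>i = 1..k. f i) = (\<Sum>i = 1..Suc k. if i \<le> k then f i else 0)" for f :: "nat \<Rightarrow> int"
    by (rule sum.mono_neutral_cong_left) auto
  have high: "(\<Sum>i = 1..k. f (Suc i)) = (\<Sum>i = 1..Suc k. if 2 \<le> i then f i else 0)" for f :: "nat \<Rightarrow> int"
  proof -
    have "(\<Sum>i = 1..Suc k. if 2 \<le> i then f i else 0) = (\<Sum>i = Suc 1..Suc k. if 2 \<le> i then f i else 0)"
      by (subst sum.atLeast_Suc_atMost) auto
    also have "\<dots> = (\<Sum>i = 1..k. f (Suc i))"
      by (subst sum.shift_bounds_cl_Suc_ivl) (intro sum.cong refl, simp)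
    finally show ?thesis ..
  qed
  \<comment> \<open>The identity holds separately for each pair of neighbours shared by jumps i and i - 1.\<close>
  have term_eq: "(if i \<le> k then if X i then lo i else 0 else 0) + (if 2 \<le> i then if X' i then hi i else 0 else 0)
     = (if 2 \<le> i then if X i then dn i else 0 else 0) + (if i \<le> k then if X' i then up i else 0 else 0)
       + (if i = 1 then if j = p then \<mu> m else 0 else 0)" if i: "i \<in> {1..Suc k}" for i
  proof -
    have bottom: "c 0 l = Suc m" and top: "c (Suc k) l = 0" if "1 \<le> l" "l \<le> p" for l
      using c that unfolding jump_array_def by auto
    have left: "c r 0 = 1" and right: "c r (Suc p) = m" if "1 \<le> r" "r \<le> k" for r
      using c that unfolding jump_array_def by auto
    consider "i = 1" | "2 \<le> i" "i \<le> k" | "i = Suc k" "2 \<le> i" using i assms(5) by fastforce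
    then show ?thesis
    proof cases
      case 1
      show ?thesis
        using 1 assms bottom[of j] right[of 1] jump_array_le(1)[OF c, of 1 "Suc j"]
        by (auto simp: X_def X'_def lo_def up_def min_def not_less not_le dest: le_antisym)
    next
      case 2
      have sum_lo_hi: "lo i + hi i = dn i + up i"
        by (simp add: lo_def hi_def dn_def up_def min_def max_def)
      have "hi i = up i" if "i = Suc j"
        using that 2 left[of "i - 1"] by (simp add: hi_def up_def)
      moreover have "lo i = dn i" if "Suc j = p + i" "i \<le> j"
      proof -
        have idx: "Suc (Suc j) - i = Suc p" "Suc j - i = p" using that by auto
        have "c (i - 1) p \<le> m"
          using 2 by (intro jump_array_le(1)[OF c]) auto
        then have "c (i - 1) p - 1 \<le> m" by simp
        moreover have "c i (Suc p) = m" using 2 right[of i] by simp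
        ultimately show ?thesis unfolding lo_def dn_def idx by (metis min.absorb2)
      qed
      moreover have "X' i \<Longrightarrow> \<not> X i \<Longrightarrow> i = Suc j"
        and "X i \<Longrightarrow> \<not> X' i \<Longrightarrow> Suc j = p + i \<and> i \<le> j"
        unfolding X_def X'_def by linarith+
      ultimately have "X' i \<Longrightarrow> \<not> X i \<Longrightarrow> hi i = up i" and "X i \<Longrightarrow> \<not> X' i \<Longrightarrow> lo i = dn i"
        by blast+
      then have "(if X i then lo i else 0) + (if X' i then hi i else 0)
        = (if X i then dn i else 0) + (if X' i then up i else 0)"
        using sum_lo_hi by auto
      then show ?thesis using 2 by simp
    next
      case 3
      have "hi i = 0" if "j = k"
        using that 3 assms left[of k] top[of 1] by (simp add: hi_def)
      moreover have "hi i = dn i" if "k < j"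
      proof -
        have "Suc (Suc j) - i = Suc (j - k)" "Suc (j - k) \<le> p" using that assms 3 by auto
        then show ?thesis using top[of "Suc (j - k)"] 3 by (simp add: hi_def dn_def)
      qed
      ultimately show ?thesis using 3 assms unfolding X_def X'_def by auto
    qed
  qed
  have "(\<Sum>i = 1..k. if X i then lo i else 0) + (\<Sum>i = 1..k. if X' (Suc i) then hi (Suc i) else 0)
     = (\<Sum>i = 1..k. if X (Suc i) then dn (Suc i) else 0) + (\<Sum>i = 1..k. if X' i then up i else 0)
       + (if j = p then \<mu> m else 0)"
  proof -
    have "(\<Sum>i = 1..Suc k. if i = 1 then if j = p then \<mu> m else 0 else 0) = (if j = p then \<mu> m else 0)"
      by (subst sum.delta) auto
    then show ?thesis
      unfolding low[of "\<lambda>i. if X i then lo i else 0"] low[of "\<lambda>i. if X' i then up i else 0"]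
        high[of "\<lambda>i. if X i then dn i else 0"] high[of "\<lambda>i. if X' i then hi i else 0"]
      using sum.cong[OF refl term_eq, of "{1..Suc k}"] by (simp only: sum.distrib)
  qed
  moreover have "(if i < Suc j \<and> Suc j \<le> p + i then
             \<mu> (min (c i (Suc (Suc j - i))) (c (i - 1) (Suc j - i) - 1))
           + \<mu> (max (c i (Suc j - i - 1) - 1) (c (Suc i) (Suc j - i))) else 0)
     = (if X i then lo i else 0) + (if X' (Suc i) then hi (Suc i) else 0)" for i
    by (auto simp: X_def X'_def lo_def hi_def Suc_diff_le max.commute)
  ultimately show ?thesis
    by (simp add: sum.distrib X_def X'_def dn_def up_def less_Suc_eq_le Suc_le_eq cong: if_cong)
qed

text \<open>
  Subtracting \<mu> from row j and adding it to row j+1 does not lower the maximal weight, provided that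
  in every interval of columns each jump can be replaced by one that loses at most the
  boundary term \<mu>(\<beta>) + \<mu>(\<alpha> - 1). Jumps of one antidiagonal are not neighbours of each other, so
  they can be replaced independently, and the losses are made up by the jumps of the two adjacent
  antidiagonals, whose weights involve rows j and j+1 as well.
\<close>

lemma exchange_rows:
  fixes U U' :: "nat \<Rightarrow> nat \<Rightarrow> int" and \<mu> :: "nat \<Rightarrow> int"
  assumes c: "jump_array k p m c" and \<mu>: "\<mu> 0 = 0" and j: "1 \<le> j" "j < k + p" and k: "1 \<le> k"
    and lower: "\<And>x. U' j x = U j x - \<mu> x"
    and upper: "\<And>x. U' (Suc j) x = U (Suc j) x + \<mu> x"
    and other: "\<And>r. r \<noteq> j \<Longrightarrow> r \<noteq> Suc j \<Longrightarrow> U' r = U r"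
    and exchange: "\<And>\<alpha> \<beta> z. \<lbrakk>1 \<le> \<alpha>; \<alpha> \<le> z; z \<le> \<beta>\<rbrakk> \<Longrightarrow>
      \<exists>z'. \<alpha> \<le> z' \<and> z' \<le> \<beta> \<and>
        U j z - U (Suc j) (z - 1) \<le> U' j z' - U' (Suc j) (z' - 1) + \<mu> \<beta> + \<mu> (\<alpha> - 1)"
  shows "\<exists>c'. jump_array k p m c' \<and> jump_weight U k p m c \<le> jump_weight U' k p m c'"
proof -
  define lo where "lo i l = max (c i (l - 1) - 1) (c (Suc i) l)" for i l
  define hi where "hi i l = min (c i (Suc l)) (c (i - 1) l - 1)" for i l
  define cell where "cell i l \<longleftrightarrow> i \<in> {1..k} \<and> l \<in> {1..p} \<and> l + i = Suc j" for i l
  define jump where "jump V i l x = V (i + l - 1) x - V (i + l) (x - 1)"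
    for V :: "nat \<Rightarrow> nat \<Rightarrow> int" and i l x
  have mono: "c i l \<le> c i (Suc l)" if "i \<in> {1..k}" "l \<le> p" for i l
    using c that unfolding jump_array_def by auto
  have strict: "c (Suc i) l < c i l" if "i \<le> k" "l \<in> {1..p}" for i l
    using c that unfolding jump_array_def by auto
  have pos: "1 \<le> c i l" if "i \<in> {1..k}" "l \<le> Suc p" for i l
    using jump_array_le(2)[OF c] that by auto
  have range: "Suc (lo i l) \<le> c i l \<and> c i l \<le> hi i l" if "cell i l" for i l
  proof -
    have "c i (l - 1) \<le> c i l" "c i l < c (i - 1) l"
      using that mono[of i "l - 1"] strict[of "i - 1" l] by (auto simp: cell_def)
    then show ?thesis
      using that mono[of i l] strict[of i l] pos[of i l] by (auto simp: cell_def lo_def hi_def)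
  qed
  have "\<exists>z. Suc (lo i l) \<le> z \<and> z \<le> hi i l \<and>
      jump U i l (c i l) \<le> jump U' i l z + \<mu> (hi i l) + \<mu> (lo i l)" if "cell i l" for i l
  proof -
    have "i + l = Suc j" using that by (auto simp: cell_def)
    then show ?thesis
      using exchange[of "Suc (lo i l)" "c i l" "hi i l"] range[OF that] by (simp add: jump_def)
  qed
  then obtain z where z: "\<And>i l. cell i l \<Longrightarrow> Suc (lo i l) \<le> z i l \<and> z i l \<le> hi i l \<and>
      jump U i l (c i l) \<le> jump U' i l (z i l) + \<mu> (hi i l) + \<mu> (lo i l)"
    by metis
  define c' where "c' i l = (if cell i l then z i l else c i l)" for i l
  have c': "jump_array k p m c'"
    unfolding jump_array_def
  proof (intro conjI ballI allI impI)
    fix i l assume i: "i \<in> {1..k}" and l: "l \<le> p"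
    consider "cell i l" "\<not> cell i (Suc l)" | "\<not> cell i l" "cell i (Suc l)" | "\<not> cell i l" "\<not> cell i (Suc l)"
      by (auto simp: cell_def)
    then show "c' i l \<le> c' i (Suc l)"
      using z[of i l] z[of i "Suc l"] mono[OF i l] by cases (auto simp: c'_def lo_def hi_def)
  next
    fix i l assume l: "l \<in> {1..p}" and i: "i \<le> k"
    consider "cell i l" "\<not> cell (Suc i) l" | "\<not> cell i l" "cell (Suc i) l" | "\<not> cell i l" "\<not> cell (Suc i) l"
      by (auto simp: cell_def)
    then show "c' (Suc i) l < c' i l"
      using z[of i l] z[of "Suc i" l] strict[OF i l] by cases (auto simp: c'_def lo_def hi_def Suc_le_eq)
  qed (use c in \<open>auto simp: c'_def cell_def jump_array_def\<close>)
  \<comment> \<open>The third and the fourth term are the gains of jumps into row j and out of row j + 1.\<close>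
  have jumps: "jump U i l (c i l)
        - (if l + i = Suc j then \<mu> (hi i l) + \<mu> (lo i l) else 0)
        + (if l + i = j then \<mu> (c i l - 1) else 0)
        + (if l + i = Suc (Suc j) then \<mu> (c i l) else 0) \<le> jump U' i l (c' i l)"
    if "i \<in> {1..k}" "l \<in> {1..p}" for i l
  proof (cases "l + i = Suc j")
    case True
    then have "cell i l" using that by (simp add: cell_def)
    then show ?thesis using z[of i l] True by (simp add: c'_def)
  next
    case False
    have other': "r \<noteq> j \<Longrightarrow> r \<noteq> Suc j \<Longrightarrow> U' r x = U r x" for r x using other by metis
    consider "i + l = j" | "i + l = Suc (Suc j)" | "i + l \<noteq> j" "i + l \<noteq> Suc j" "i + l \<noteq> Suc (Suc j)"
      using False by (auto simp: add.commute)
    then show ?thesis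
      using False that by cases (auto simp: c'_def cell_def jump_def lower upper other' add.commute)
  qed
  have ends: "(\<Sum>i = 1..k. U' (p + i) m) = (\<Sum>i = 1..k. U (p + i) m) + (if j = p then \<mu> m else 0)"
  proof -
    have "(\<Sum>i = 1..k. U' (p + i) m) = (\<Sum>i = 1..k. U (p + i) m
        - (if i = j - p then (if p < j then \<mu> m else 0) else 0)
        + (if i = Suc j - p then (if p \<le> j then \<mu> m else 0) else 0))"
      using lower upper other by (intro sum.cong refl) (auto split: if_splits)
    also have "\<dots> = (\<Sum>i = 1..k. U (p + i) m)
        - (if j - p \<in> {1..k} then (if p < j then \<mu> m else 0) else 0)
        + (if Suc j - p \<in> {1..k} then (if p \<le> j then \<mu> m else 0) else 0)"
      by (simp only: sum.distrib sum_subtractf sum.delta finite_atLeastAtMost)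
    finally show ?thesis using j k by auto
  qed
  define level where "level = (\<Sum>i = 1..k. if i < Suc j \<and> Suc j \<le> p + i
      then \<mu> (hi i (Suc j - i)) + \<mu> (lo i (Suc j - i)) else 0)"
  define below where "below = (\<Sum>i = 1..k. if i < j \<and> j \<le> p + i then \<mu> (c i (j - i) - 1) else 0)"
  define above where "above = (\<Sum>i = 1..k. if i < Suc (Suc j) \<and> Suc (Suc j) \<le> p + i
      then \<mu> (c i (Suc (Suc j) - i)) else 0)"
  define corner where "corner = (if j = p then \<mu> m else 0)"
  have balance: "level = below + above + corner"
    unfolding level_def below_def above_def corner_def hi_def lo_def
    by (rule antidiagonal_balance[where \<mu> = \<mu>, OF c \<mu> j k])
  have "(\<Sum>i = 1..k. \<Sum>l = 1..p. jump U i l (c i l)) - level + below + above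
      = (\<Sum>i = 1..k. \<Sum>l = 1..p. jump U i l (c i l)
        - (if l + i = Suc j then \<mu> (hi i l) + \<mu> (lo i l) else 0)
        + (if l + i = j then \<mu> (c i l - 1) else 0)
        + (if l + i = Suc (Suc j) then \<mu> (c i l) else 0))"
    unfolding level_def below_def above_def
    by (simp only: sum.distrib sum_subtractf sum_antidiagonal)
  also have "\<dots> \<le> (\<Sum>i = 1..k. \<Sum>l = 1..p. jump U' i l (c' i l))"
    by (intro sum_mono jumps)
  finally have "(\<Sum>i = 1..k. \<Sum>l = 1..p. jump U i l (c i l))
      \<le> (\<Sum>i = 1..k. \<Sum>l = 1..p. jump U' i l (c' i l)) + corner"
    unfolding balance by (simp only: algebra_simps)
  then have "jump_weight U k p m c \<le> jump_weight U' k p m c'"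
    unfolding jump_weight_def ends corner_def[symmetric] jump_def by (simp only: algebra_simps)
  with c' show ?thesis by blast
qed

text \<open>
  The rows are u below and v above; b is the last passage time through both of them, and the
  upper row of the transform. So \<mu> is the running maximum of \<open>gain\<close>, the weight of a
  jump from u to v, started at 0; \<open>gain'\<close> is the weight of a jump after the transform.
\<close>

locale pitman =
  fixes u v b \<mu> :: "nat \<Rightarrow> int"
  assumes b_0: "b 0 = v 0"
    and b_Suc: "\<And>x. b (Suc x) = max (b x) (u (Suc x)) + (v (Suc x) - v x)"
    and mu: "\<And>x. \<mu> x = b x - v x"
begin

definition "gain x = u x - v (x - 1)"
definition "gain' x = (u x - \<mu> x) - (v (x - 1) + \<mu> (x - 1))"

lemma mu_0: "\<mu> 0 = 0"
  by (simp add: mu b_0)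

lemma mu_step: "1 \<le> x \<Longrightarrow> \<mu> x = max (\<mu> (x - 1)) (gain x)"
  by (cases x) (auto simp: mu b_Suc gain_def)

lemma mu_mono: "x \<le> y \<Longrightarrow> \<mu> x \<le> \<mu> y"
proof (induction y rule: dec_induct)
  case (step y)
  then show ?case using mu_step[of "Suc y"] by simp
qed simp

lemma record_value: "x \<le> y \<Longrightarrow> \<mu> y = \<mu> x \<or> (\<exists>z. x < z \<and> z \<le> y \<and> gain z = \<mu> y)"
proof (induction y rule: dec_induct)
  case (step y)
  show ?case
  proof (cases "\<mu> (Suc y) = gain (Suc y)")
    case True
    then show ?thesis using step by (intro disjI2 exI[of _ "Suc y"]) auto
  next
    case False
    then have "\<mu> (Suc y) = \<mu> y" using mu_step[of "Suc y"] by (auto simp: max_def split: if_splits)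
    then show ?thesis using step by (metis le_SucI)
  qed
qed simp

text \<open>
  At the first column after x where the running maximum increases, it equals the gain there, while its
  previous value is still \<mu>(x); the transformed gain there is therefore -\<mu>(x).
\<close>

lemma first_record: "x \<le> y \<Longrightarrow> \<mu> y = \<mu> x \<or> (\<exists>z. x < z \<and> z \<le> y \<and> gain' z = - \<mu> x)"
proof (induction y rule: dec_induct)
  case (step y)
  have "gain' (Suc y) = - \<mu> x" if "\<mu> y = \<mu> x" "\<mu> (Suc y) \<noteq> \<mu> x"
    using that mu_step[of "Suc y"] by (auto simp: gain_def gain'_def max_def split: if_splits)
  then show ?case using step by (metis le_SucI le_refl less_Suc_eq_le)
qed simp

text \<open>
  If the running maximum has not moved between \<alpha> - 1 and z - 1, the same jump works; otherwise
  the jump at the first record beyond \<alpha> - 1 does.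
\<close>

lemma exchange_forward:
  assumes "1 \<le> \<alpha>" "\<alpha> \<le> z" "z \<le> \<beta>"
  shows "\<exists>z'. \<alpha> \<le> z' \<and> z' \<le> \<beta> \<and> gain z \<le> gain' z' + \<mu> \<beta> + \<mu> (\<alpha> - 1)"
proof -
  have "\<alpha> - 1 \<le> z - 1" using assms by simp
  then consider "\<mu> (z - 1) = \<mu> (\<alpha> - 1)"
    | y where "\<alpha> - 1 < y" "y \<le> z - 1" "gain' y = - \<mu> (\<alpha> - 1)"
    using first_record by blast
  then show ?thesis
  proof cases
    case 1
    then show ?thesis
      using assms mu_mono[of z \<beta>] by (intro exI[of _ z]) (auto simp: gain_def gain'_def)
  next
    case 2
    then show ?thesis
      using assms mu_mono[of z \<beta>] mu_step[of z] by (intro exI[of _ y]) auto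
  qed
qed

text \<open>
  If the running maximum does not move between z and \<beta>, the same jump works; otherwise the jump that
  attains the value \<mu>(\<beta>) does.
\<close>

lemma exchange_backward:
  assumes "1 \<le> \<alpha>" "\<alpha> \<le> z" "z \<le> \<beta>"
  shows "\<exists>z'. \<alpha> \<le> z' \<and> z' \<le> \<beta> \<and> gain' z + \<mu> \<beta> + \<mu> (\<alpha> - 1) \<le> gain z'"
proof -
  have *: "\<mu> (\<alpha> - 1) \<le> \<mu> (z - 1)" using assms by (intro mu_mono) auto
  have g: "gain' z = gain z - \<mu> z - \<mu> (z - 1)" by (simp add: gain_def gain'_def)
  have "gain z \<le> \<mu> z" using mu_step[of z] assms by simp
  consider "\<mu> \<beta> = \<mu> z" | y where "z < y" "y \<le> \<beta>" "gain y = \<mu> \<beta>"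
    using record_value[OF assms(3)] by blast
  then show ?thesis
  proof cases
    case 1
    then show ?thesis using * g assms by (intro exI[of _ z]) auto
  next
    case 2
    then show ?thesis using * g assms \<open>gain z \<le> \<mu> z\<close> by (intro exI[of _ y]) auto
  qed
qed

end

text \<open>
  Comparison of maximal weights for all column numbers m at once, without mentioning a maximum.
\<close>

definition dominated :: "nat \<Rightarrow> nat \<Rightarrow> (nat \<Rightarrow> nat \<Rightarrow> int) \<Rightarrow> (nat \<Rightarrow> nat \<Rightarrow> int) \<Rightarrow> bool" where
  "dominated k p U V \<longleftrightarrow> (\<forall>m c. jump_array k p m c \<longrightarrow>
     (\<exists>c'. jump_array k p m c' \<and> jump_weight U k p m c \<le> jump_weight V k p m c'))"

lemma dominated_refl: "dominated k p U U"
  by (auto simp: dominated_def)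

lemma dominated_trans: "dominated k p U V \<Longrightarrow> dominated k p V W \<Longrightarrow> dominated k p U W"
  unfolding dominated_def by (meson order_trans)

text \<open>
  The exchange applies in both directions, with \<mu> and with -\<mu>, so the transform preserves the maximum.
\<close>

lemma pitman_transform:
  assumes j: "1 \<le> j" "j < k + p" and k: "1 \<le> k"
    and b_0: "V (Suc j) 0 = U (Suc j) 0"
    and b_Suc: "\<And>x. V (Suc j) (Suc x) =
      max (V (Suc j) x) (U j (Suc x)) + (U (Suc j) (Suc x) - U (Suc j) x)"
    and total: "\<And>x. V j x + V (Suc j) x = U j x + U (Suc j) x"
    and other: "\<And>r. r \<noteq> j \<Longrightarrow> r \<noteq> Suc j \<Longrightarrow> V r = U r"
  shows "dominated k p U V" and "dominated k p V U"
proof -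
  define \<mu> where "\<mu> x = V (Suc j) x - U (Suc j) x" for x
  interpret pitman "U j" "U (Suc j)" "V (Suc j)" \<mu>
    by unfold_locales (use b_0 b_Suc in \<open>auto simp: \<mu>_def\<close>)
  have V: "V j x = U j x - \<mu> x" "V (Suc j) x = U (Suc j) x + \<mu> x" for x
    using total[of x] by (auto simp: \<mu>_def)
  have "\<exists>z'. \<alpha> \<le> z' \<and> z' \<le> \<beta> \<and>
      U j z - U (Suc j) (z - 1) \<le> V j z' - V (Suc j) (z' - 1) + \<mu> \<beta> + \<mu> (\<alpha> - 1)"
    if "1 \<le> \<alpha>" "\<alpha> \<le> z" "z \<le> \<beta>" for \<alpha> z \<beta>
    using exchange_forward[OF that] by (simp add: V gain_def gain'_def)
  then show "dominated k p U V"
    unfolding dominated_def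
    by (intro allI impI exchange_rows[where \<mu> = \<mu> and j = j]) (use mu_0 j k V other in auto)
  have "\<exists>z'. \<alpha> \<le> z' \<and> z' \<le> \<beta> \<and>
      V j z - V (Suc j) (z - 1) \<le> U j z' - U (Suc j) (z' - 1) + - \<mu> \<beta> + - \<mu> (\<alpha> - 1)"
    if "1 \<le> \<alpha>" "\<alpha> \<le> z" "z \<le> \<beta>" for \<alpha> z \<beta>
    using exchange_backward[OF that] by (auto simp: V gain_def gain'_def algebra_simps)
  then show "dominated k p V U"
    unfolding dominated_def
    by (intro allI impI exchange_rows[where \<mu> = "\<lambda>x. - \<mu> x" and j = j]) (use mu_0 j k V other in auto)
qed

section \<open>Sorting the rows\<close>

definition prefix_rows :: "(nat \<Rightarrow> nat \<Rightarrow> nat) \<Rightarrow> nat \<Rightarrow> nat \<Rightarrow> int" where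
  "prefix_rows A r x = (\<Sum>t = 1..x. int (A t r))"

text \<open>
  The first n rows are replaced by the growth of their partition, smallest part at the bottom.
\<close>

definition sorted_rows :: "(nat \<Rightarrow> nat \<Rightarrow> nat) \<Rightarrow> nat \<Rightarrow> nat \<Rightarrow> nat \<Rightarrow> int" where
  "sorted_rows A n r x = (if r \<le> n then shape A x n (n - r) else prefix_rows A r x)"

text \<open>
  What is left of row n+1 after it has passed the s largest parts of the partition of the first n rows;
  this is the word bumped out of the first s rows in Schensted insertion.
\<close>

definition bumped :: "(nat \<Rightarrow> nat \<Rightarrow> nat) \<Rightarrow> nat \<Rightarrow> nat \<Rightarrow> nat \<Rightarrow> int" where
  "bumped A n s x = prefix_rows A (Suc n) x + (\<Sum>i<s. shape A x n i - shape A x (Suc n) i)"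

definition partly_sorted_rows :: "(nat \<Rightarrow> nat \<Rightarrow> nat) \<Rightarrow> nat \<Rightarrow> nat \<Rightarrow> nat \<Rightarrow> nat \<Rightarrow> int" where
  "partly_sorted_rows A n s r x =
     (if r < Suc n - s then shape A x n (n - r)
      else if r = Suc n - s then bumped A n s x
      else if r \<le> Suc n then shape A x (Suc n) (Suc n - r)
      else prefix_rows A r x)"

text \<open>
  The growth rule for part s is the last passage recursion of the two rows formed by the old part
  s and the bumped row. For s > 0 the increment of the bumped row is
  min(a_{s-1},b_{s-1}) - d_{s-1}.
\<close>

lemma bumped_growth:
  "shape A (Suc x) (Suc n) s =
     max (shape A x (Suc n) s) (shape A (Suc x) n s) + (bumped A n s (Suc x) - bumped A n s x)"
proof (induction s)
  case 0
  show ?case by (simp add: bumped_def prefix_rows_def)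
next
  case (Suc s)
  have "max (shape A x (Suc n) s) (shape A (Suc x) n s) + min (shape A x (Suc n) s) (shape A (Suc x) n s)
    = shape A x (Suc n) s + shape A (Suc x) n s" by (simp add: max_def min_def)
  moreover have "bumped A n (Suc s) y = bumped A n s y + shape A y n s - shape A y (Suc n) s" for y
    by (simp add: bumped_def)
  ultimately show ?case using Suc by simp
qed

lemma partly_sorted_first: "partly_sorted_rows A n 0 = sorted_rows A n"
  by (auto simp: partly_sorted_rows_def sorted_rows_def bumped_def fun_eq_iff)

text \<open>
  A partition with n rows has no part beyond the n-th, so what is left after n bumps is the new part.
\<close>

lemma bumped_last: "bumped A n n x = shape A x (Suc n) n"
proof (induction x)
  case (Suc x)
  have "0 \<le> shape A x (Suc n) n" by (rule shape_nonneg)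
  then show ?case
    using Suc bumped_growth[of A x n n] shape_vanishes[of "Suc x" n n A] by simp
qed (simp add: bumped_def prefix_rows_def)

lemma partly_sorted_last: "partly_sorted_rows A n n = sorted_rows A (Suc n)"
proof (intro ext)
  fix r x
  show "partly_sorted_rows A n n r x = sorted_rows A (Suc n) r x"
    by (cases "r = 0") (auto simp: partly_sorted_rows_def sorted_rows_def bumped_last shape_vanishes)
qed

lemma partly_sorted_dominated:
  assumes "1 \<le> k" "Suc n \<le> k + p" "s \<le> n"
  shows "dominated k p (sorted_rows A n) (partly_sorted_rows A n s) \<and>
    dominated k p (partly_sorted_rows A n s) (sorted_rows A n)"
  using assms(3)
proof (induction s)
  case 0
  show ?case by (simp add: partly_sorted_first dominated_refl)
next
  case (Suc s)
  let ?U = "partly_sorted_rows A n s" and ?V = "partly_sorted_rows A n (Suc s)" and ?j = "n - s"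
  \<comment> \<open>Step s exchanges row n - s, which holds part s, with the bumped row above it.\<close>
  have lower: "?U ?j x = shape A x n s" "?V ?j x = bumped A n (Suc s) x" for x
    using Suc.prems by (auto simp: partly_sorted_rows_def Suc_diff_le)
  have upper: "?U (Suc ?j) x = bumped A n s x" "?V (Suc ?j) x = shape A x (Suc n) s" for x
    using Suc.prems by (auto simp: partly_sorted_rows_def Suc_diff_le)
  have "?V r = ?U r" if "r \<noteq> ?j" "r \<noteq> Suc ?j" for r
    using that Suc.prems by (auto simp: partly_sorted_rows_def fun_eq_iff)
  moreover have "?V ?j x + ?V (Suc ?j) x = ?U ?j x + ?U (Suc ?j) x" for x
    by (simp add: lower upper bumped_def)
  moreover have "?V (Suc ?j) (Suc x) =
      max (?V (Suc ?j) x) (?U ?j (Suc x)) + (?U (Suc ?j) (Suc x) - ?U (Suc ?j) x)" for x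
    by (simp only: lower upper bumped_growth)
  moreover have "?V (Suc ?j) 0 = ?U (Suc ?j) 0"
    by (simp add: upper bumped_def prefix_rows_def)
  moreover have "1 \<le> ?j" "?j < k + p" using Suc.prems assms by auto
  ultimately have "dominated k p ?U ?V" "dominated k p ?V ?U"
    using pitman_transform[of ?j k p ?V ?U] assms(1) by blast+
  then show ?case using Suc dominated_trans by (meson Suc_leD)
qed

lemma sorted_rows_dominated:
  assumes "1 \<le> k" "n \<le> k + p"
  shows "dominated k p (prefix_rows A) (sorted_rows A n) \<and>
    dominated k p (sorted_rows A n) (prefix_rows A)"
  using assms(2)
proof (induction n)
  case 0
  have "sorted_rows A 0 r = prefix_rows A r" if "1 \<le> r" for r
    using that by (auto simp: sorted_rows_def)
  then have "jump_weight (sorted_rows A 0) k p m c = jump_weight (prefix_rows A) k p m c" for m c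
    unfolding jump_weight_def by (intro arg_cong2[where f = "(+)"] sum.cong refl) auto
  then show ?case by (auto simp: dominated_def)
next
  case (Suc n)
  then show ?case
    using partly_sorted_dominated[of k n p n A] assms(1) dominated_trans
    unfolding partly_sorted_last by (meson Suc_leD order_refl)
qed

lemma jump_weight_sorted:
  assumes "n = k + p"
  shows "jump_weight (sorted_rows A n) k p m c = (\<Sum>s<k. shape A m n s)
    + (\<Sum>i = 1..k. \<Sum>l = 1..p. shape A (c i l) n (Suc (n - i - l)) - shape A (c i l - 1) n (n - i - l))"
proof -
  have "(\<Sum>i = 1..k. sorted_rows A n (p + i) m) = (\<Sum>i = 1..k. shape A m n (k - i))"
    unfolding assms by (intro sum.cong refl) (simp add: sorted_rows_def)
  also have "\<dots> = (\<Sum>s<k. shape A m n s)"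
    by (rule sum.reindex_bij_witness[of _ "\<lambda>s. k - s" "\<lambda>i. k - i"]) auto
  finally have ends: "(\<Sum>i = 1..k. sorted_rows A n (p + i) m) = (\<Sum>s<k. shape A m n s)" .
  have "sorted_rows A n (i + l - 1) x - sorted_rows A n (i + l) y
      = shape A x n (Suc (n - i - l)) - shape A y n (n - i - l)"
    if "i \<in> {1..k}" "l \<in> {1..p}" for i l x y
  proof -
    have "i + l \<le> n" "1 \<le> i" using that assms by auto
    then have "n - (i + l - 1) = Suc (n - i - l)" "n - (i + l) = n - i - l" "i + l - 1 \<le> n"
      by linarith+
    with \<open>i + l \<le> n\<close> show ?thesis by (simp only: sorted_rows_def if_True)
  qed
  then have "(\<Sum>i = 1..k. \<Sum>l = 1..p.
        sorted_rows A n (i + l - 1) (c i l) - sorted_rows A n (i + l) (c i l - 1))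
      = (\<Sum>i = 1..k. \<Sum>l = 1..p.
        shape A (c i l) n (Suc (n - i - l)) - shape A (c i l - 1) n (n - i - l))"
    by (intro sum.cong refl)
  with ends show ?thesis unfolding jump_weight_def by (rule arg_cong2)
qed

text \<open>
  Each jump contributes the difference of two interlacing parts in the unfavourable order.
\<close>

lemma jump_weight_sorted_le:
  assumes "n = k + p" "jump_array k p m c"
  shows "jump_weight (sorted_rows A n) k p m c \<le> (\<Sum>s<k. shape A m n s)"
proof -
  have "shape A (c i l) n (Suc (n - i - l)) \<le> shape A (c i l - 1) n (n - i - l)"
    if "i \<in> {1..k}" "l \<in> {1..p}" for i l
  proof -
    have "1 \<le> c i l" using jump_array_le(2)[OF assms(2)] that by auto
    then show ?thesis
      using shape_interlaced[of A "c i l - 1" n] by (simp add: interlaced_def)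
  qed
  then have "(\<Sum>i = 1..k. \<Sum>l = 1..p. shape A (c i l) n (Suc (n - i - l)) - shape A (c i l - 1) n (n - i - l)) \<le> 0"
    by (intro sum_nonpos) auto
  then show ?thesis unfolding jump_weight_sorted[OF assms(1)] by linarith
qed

text \<open>
  The leftmost possible jumps lie in columns where both parts involved still vanish, because a
  partition with x columns has at most x parts.
\<close>

lemma jump_weight_sorted_attained:
  assumes "n = k + p" "1 \<le> k" "k \<le> m"
  shows "\<exists>c. jump_array k p m c \<and> jump_weight (sorted_rows A n) k p m c = (\<Sum>s<k. shape A m n s)"
proof -
  define c where "c i l = (if i = 0 then Suc m else if k < i then 0 else if l = 0 then 1
      else if l = Suc p then m else Suc k - i)" for i l
  have "jump_array k p m c"
    using assms by (auto simp: jump_array_def c_def)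
  moreover have "shape A (c i l) n (Suc (n - i - l)) - shape A (c i l - 1) n (n - i - l) = 0"
    if "i \<in> {1..k}" "l \<in> {1..p}" for i l
  proof -
    have "c i l \<le> Suc (n - i - l)" using that assms by (auto simp: c_def)
    then show ?thesis by (subst (1 2) shape_vanishes) auto
  qed
  ultimately show ?thesis unfolding jump_weight_sorted[OF assms(1)] by (intro exI[of _ c]) simp
qed

theorem max_jump_weight:
  assumes "1 \<le> k" "k \<le> m"
  shows "\<forall>c. jump_array k p m c \<longrightarrow>
      jump_weight (prefix_rows A) k p m c \<le> (\<Sum>s<k. shape A m (k + p) s)"
    and "\<exists>c. jump_array k p m c \<and>
      jump_weight (prefix_rows A) k p m c = (\<Sum>s<k. shape A m (k + p) s)"
proof -
  have dom: "dominated k p (prefix_rows A) (sorted_rows A (k + p))"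
    "dominated k p (sorted_rows A (k + p)) (prefix_rows A)"
    using sorted_rows_dominated[OF assms(1) order_refl] by auto
  show le: "\<forall>c. jump_array k p m c \<longrightarrow>
      jump_weight (prefix_rows A) k p m c \<le> (\<Sum>s<k. shape A m (k + p) s)"
    using dom(1) jump_weight_sorted_le[OF refl] unfolding dominated_def by (meson order_trans)
  obtain c where "jump_array k p m c"
    "jump_weight (sorted_rows A (k + p)) k p m c = (\<Sum>s<k. shape A m (k + p) s)"
    using jump_weight_sorted_attained[OF refl assms] by blast
  then show "\<exists>c. jump_array k p m c \<and>
      jump_weight (prefix_rows A) k p m c = (\<Sum>s<k. shape A m (k + p) s)"
    using dom(2) le unfolding dominated_def by (metis order_antisym)
qed

section \<open>Last passage times follow the growth rule\<close>

text \<open>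
  An up-right path occupies an interval in each row; y r is the column in which it enters row r, and it
  leaves row r in the column where it enters row r+1.
\<close>

lemma up_right_path_rows:
  assumes "up_right_path p" "connects p (s, a) (t, b)"
  shows "\<exists>y. y a = s \<and> y (Suc b) = t \<and> a \<le> b \<and> (\<forall>r\<in>{a..b}. y r \<le> y (Suc r)) \<and>
    set p = {(u, r). a \<le> r \<and> r \<le> b \<and> y r \<le> u \<and> u \<le> y (Suc r)} \<and>
    path_weight A p = (\<Sum>r = a..b. \<Sum>u = y r..y (Suc r). A u r)"
  using assms
proof (induction p arbitrary: s a)
  case Nil
  then show ?case by (simp add: connects_def)
next
  case (Cons v p)
  have v: "v = (s, a)" using Cons.prems by (simp add: connects_def)
  show ?case
  proof (cases p)
    case Nil
    then have "t = s" "b = a" using Cons.prems v by (auto simp: connects_def)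
    then show ?thesis using Nil v
      by (intro exI[of _ "\<lambda>_. s"]) (auto simp: path_weight_def)
  next
    case (Cons v' p')
    have p: "up_right_path p" "connects p v' (t, b)"
      using Cons.prems Cons by (auto simp: up_right_path_def connects_def)
    have "v' = (s, Suc a) \<or> v' = (Suc s, a)"
      using Cons.prems Cons v by (auto simp: up_right_path_def)
    then show ?thesis
    proof
      assume v': "v' = (s, Suc a)"
      obtain y where y: "y (Suc a) = s" "y (Suc b) = t" "Suc a \<le> b" "\<forall>r\<in>{Suc a..b}. y r \<le> y (Suc r)"
        "set p = {(u, r). Suc a \<le> r \<and> r \<le> b \<and> y r \<le> u \<and> u \<le> y (Suc r)}"
        "path_weight A p = (\<Sum>r = Suc a..b. \<Sum>u = y r..y (Suc r). A u r)"
        using Cons.IH[OF p(1) p(2)[unfolded v']] by blast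
      define y' where "y' = y(a := s)"
      have y': "y' a = s" "\<And>r. a < r \<Longrightarrow> y' r = y r" by (auto simp: y'_def)
      have "set (v # p) = {(u, r). a \<le> r \<and> r \<le> b \<and> y' r \<le> u \<and> u \<le> y' (Suc r)}"
      proof -
        have "(u, r) \<in> set (v # p) \<longleftrightarrow> a \<le> r \<and> r \<le> b \<and> y' r \<le> u \<and> u \<le> y' (Suc r)" for u r
          using y(1,3) y' by (cases "r = a") (auto simp: y(5) v)
        then show ?thesis by auto
      qed
      moreover have "path_weight A (v # p) = (\<Sum>r = a..b. \<Sum>u = y' r..y' (Suc r). A u r)"
      proof -
        have "(\<Sum>r = Suc a..b. \<Sum>u = y' r..y' (Suc r). A u r) = path_weight A p"
          unfolding y(6) by (intro sum.cong refl) (simp add: y')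
        moreover have "path_weight A (v # p) = A s a + path_weight A p"
          by (simp add: path_weight_def v)
        ultimately show ?thesis
          using y(1,3) by (subst sum.atLeast_Suc_atMost) (auto simp: y')
      qed
      moreover have "\<forall>r\<in>{a..b}. y' r \<le> y' (Suc r)"
        using y y' by (auto simp: le_eq_less_or_eq[of a])
      ultimately show ?thesis
        using y y' by (intro exI[of _ y']) auto
    next
      assume v': "v' = (Suc s, a)"
      obtain y where y: "y a = Suc s" "y (Suc b) = t" "a \<le> b" "\<forall>r\<in>{a..b}. y r \<le> y (Suc r)"
        "set p = {(u, r). a \<le> r \<and> r \<le> b \<and> y r \<le> u \<and> u \<le> y (Suc r)}"
        "path_weight A p = (\<Sum>r = a..b. \<Sum>u = y r..y (Suc r). A u r)"
        using Cons.IH[OF p(1) p(2)[unfolded v']] by blast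
      have ya: "Suc s \<le> y (Suc a)" using y(1,3,4) by (metis atLeastAtMost_iff order_refl)
      define y' where "y' = y(a := s)"
      have y': "y' a = s" "\<And>r. a < r \<Longrightarrow> y' r = y r" by (auto simp: y'_def)
      have "set (v # p) = {(u, r). a \<le> r \<and> r \<le> b \<and> y' r \<le> u \<and> u \<le> y' (Suc r)}"
      proof -
        have "(u, r) \<in> set (v # p) \<longleftrightarrow> a \<le> r \<and> r \<le> b \<and> y' r \<le> u \<and> u \<le> y' (Suc r)" for u r
          using y(1,3) y' ya by (cases "r = a") (auto simp: y(5) v)
        then show ?thesis by auto
      qed
      moreover have "path_weight A (v # p) = (\<Sum>r = a..b. \<Sum>u = y' r..y' (Suc r). A u r)"
      proof -
        have "(\<Sum>r = Suc a..b. \<Sum>u = y' r..y' (Suc r). A u r) = (\<Sum>r = Suc a..b. \<Sum>u = y r..y (Suc r). A u r)"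
          by (intro sum.cong refl) (simp add: y')
        moreover have "path_weight A p = (\<Sum>u = Suc s..y (Suc a). A u a) + (\<Sum>r = Suc a..b. \<Sum>u = y r..y (Suc r). A u r)"
          using y(1,3) unfolding y(6) by (subst sum.atLeast_Suc_atMost) auto
        moreover have "(\<Sum>u = s..y (Suc a). A u a) = A s a + (\<Sum>u = Suc s..y (Suc a). A u a)"
          using ya by (intro sum.atLeast_Suc_atMost) simp
        moreover have "path_weight A (v # p) = A s a + path_weight A p"
          by (simp add: path_weight_def v)
        ultimately show ?thesis
          using y(1,3) by (subst sum.atLeast_Suc_atMost) (auto simp: y' add.assoc)
      qed
      moreover have "\<forall>r\<in>{a..b}. y' r \<le> y' (Suc r)"
        using y y' ya by (auto simp: le_eq_less_or_eq[of a])
      ultimately show ?thesis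
        using y y' by (intro exI[of _ y']) auto
    qed
  qed
qed

lemma horizontal_path:
  fixes A :: "nat \<Rightarrow> nat \<Rightarrow> 'a::linordered_semidom" and r s t :: nat
  assumes "s \<le> t"
  defines "q \<equiv> map (\<lambda>u. (u, r)) [s..<Suc t]"
  shows "up_right_path q" "q \<noteq> []" "hd q = (s, r)" "last q = (t, r)" "set q = {(u, r) | u. s \<le> u \<and> u \<le> t}"
    "path_weight A q = (\<Sum>u = s..t. A u r)"
proof -
  have lt: "s < Suc t" and ne: "[s..<Suc t] \<noteq> []" using assms(1) by auto
  have nth: "q ! i = (s + i, r)" if "i < length q" for i
  proof -
    have "i < length [s..<Suc t]" "s + i < Suc t" using that unfolding q_def length_map length_upt by auto
    then show ?thesis by (simp only: q_def nth_map nth_upt)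
  qed
  show "up_right_path q"
    unfolding up_right_path_def
    by (rule successively_conv_nth[THEN iffD2]) (simp add: nth)
  show "q \<noteq> []" using ne by (simp only: q_def map_is_Nil_conv not_False_eq_True)
  show "hd q = (s, r)" "last q = (t, r)"
    using lt unfolding q_def hd_map[OF ne] last_map[OF ne] by (simp_all only: hd_upt last_upt diff_Suc_1)
  show "set q = {(u, r) | u. s \<le> u \<and> u \<le> t}"
    by (auto simp: q_def simp del: upt_Suc)
  show "path_weight A q = (\<Sum>u = s..t. A u r)"
    by (simp add: q_def path_weight_def o_def interv_sum_list_conv_sum_set_nat
        atLeastLessThanSuc_atLeastAtMost del: upt_Suc)
qed

lemma rows_up_right_path:
  assumes "a \<le> b" "\<forall>r\<in>{a..b}. y r \<le> y (Suc r)"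
  shows "\<exists>p. up_right_path p \<and> connects p (y a, a) (y (Suc b), b) \<and>
    set p = {(u, r). a \<le> r \<and> r \<le> b \<and> y r \<le> u \<and> u \<le> y (Suc r)} \<and>
    path_weight A p = (\<Sum>r = a..b. \<Sum>u = y r..y (Suc r). A u r)"
  using assms
proof (induction b rule: dec_induct)
  case base
  have le: "y a \<le> y (Suc a)" using base by simp
  have "set (map (\<lambda>u. (u, a)) [y a..<Suc (y (Suc a))]) =
      {(u, r). a \<le> r \<and> r \<le> a \<and> y r \<le> u \<and> u \<le> y (Suc r)}"
    unfolding horizontal_path(5)[OF le] by auto
  then show ?case
    using horizontal_path[OF le, where r = a]
    by (intro exI[of _ "map (\<lambda>u. (u, a)) [y a..<Suc (y (Suc a))]"]) (simp add: connects_def del: upt_Suc)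
next
  case (step b)
  then obtain p where p: "up_right_path p" "connects p (y a, a) (y (Suc b), b)"
    "set p = {(u, r). a \<le> r \<and> r \<le> b \<and> y r \<le> u \<and> u \<le> y (Suc r)}"
    "path_weight A p = (\<Sum>r = a..b. \<Sum>u = y r..y (Suc r). A u r)"
    by auto
  define q where "q = map (\<lambda>u. (u, Suc b)) [y (Suc b)..<Suc (y (Suc (Suc b)))]"
  have "y (Suc b) \<le> y (Suc (Suc b))" using step by simp
  note q = horizontal_path[OF this, where r = "Suc b", folded q_def]
  have "up_right_path (p @ q)"
    using p(1,2) q(1-3) unfolding up_right_path_def connects_def by (simp add: successively_append_iff)
  moreover have "connects (p @ q) (y a, a) (y (Suc (Suc b)), Suc b)"
    using p(2) q(2,4) unfolding connects_def by simp
  moreover have "path_weight A (p @ q) = (\<Sum>r = a..Suc b. \<Sum>u = y r..y (Suc r). A u r)"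
    using p(4) q(6) step.hyps by (simp add: path_weight_def)
  moreover have "set (p @ q) = {(u, r). a \<le> r \<and> r \<le> Suc b \<and> y r \<le> u \<and> u \<le> y (Suc r)}"
    using step.hyps by (auto simp: p(3) q(5) le_Suc_eq)
  ultimately show ?case by blast
qed

lemma prefix_rows_diff:
  assumes "1 \<le> a" "a \<le> b"
  shows "int (\<Sum>u = a..b. A u r) = prefix_rows A r b - prefix_rows A r (a - 1)"
proof -
  have "{1..b} = {1..a - 1} \<union> {a..b}" using assms by auto
  then have "(\<Sum>u = 1..b. int (A u r)) = (\<Sum>u = 1..a - 1. int (A u r)) + (\<Sum>u = a..b. int (A u r))"
    by (simp only:) (rule sum.union_disjoint, use assms in auto)
  then show ?thesis by (simp add: prefix_rows_def)
qed

text \<open>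
  Summation by parts: the terms of row r are regrouped by jumps. The path starts in column 1, where the
  prefix sum to be subtracted is empty.
\<close>

lemma rows_weight:
  assumes "y 0 = 1" "\<forall>l\<le>p. y l \<le> y (Suc l)"
  shows "int (\<Sum>r = i..p + i. \<Sum>u = y (r - i)..y (Suc r - i). A u r) = prefix_rows A (p + i) (y (Suc p)) +
    (\<Sum>l = 1..p. prefix_rows A (i + l - 1) (y l) - prefix_rows A (i + l) (y l - 1))"
  using assms
proof (induction p)
  case 0
  then show ?case by (simp add: prefix_rows_def)
next
  case (Suc p)
  have pos: "1 \<le> y l" if "l \<le> Suc p" for l
    using that by (induction l) (use Suc.prems in \<open>auto intro: order_trans\<close>)
  have "int (\<Sum>u = y (Suc p)..y (Suc (Suc p)). A u (Suc p + i)) =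
      prefix_rows A (Suc p + i) (y (Suc (Suc p))) - prefix_rows A (Suc p + i) (y (Suc p) - 1)"
    using pos[of "Suc p"] Suc.prems by (intro prefix_rows_diff) auto
  moreover have "(\<Sum>r = i..Suc p + i. \<Sum>u = y (r - i)..y (Suc r - i). A u r) =
      (\<Sum>r = i..p + i. \<Sum>u = y (r - i)..y (Suc r - i). A u r) +
      (\<Sum>u = y (Suc p)..y (Suc (Suc p)). A u (Suc p + i))"
    by (simp add: Suc_diff_le)
  moreover have "int (\<Sum>r = i..p + i. \<Sum>u = y (r - i)..y (Suc r - i). A u r) = prefix_rows A (p + i) (y (Suc p)) +
    (\<Sum>l = 1..p. prefix_rows A (i + l - 1) (y l) - prefix_rows A (i + l) (y l - 1))"
    using Suc by simp
  moreover have "(\<Sum>l = 1..Suc p. prefix_rows A (i + l - 1) (y l) - prefix_rows A (i + l) (y l - 1)) =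
    (\<Sum>l = 1..p. prefix_rows A (i + l - 1) (y l) - prefix_rows A (i + l) (y l - 1))
    + (prefix_rows A (p + i) (y (Suc p)) - prefix_rows A (Suc p + i) (y (Suc p) - 1))"
    by (simp add: add.commute)
  ultimately show ?case by simp
qed

lemma jump_weight_eq_rows:
  assumes "jump_array k p m c"
  shows "jump_weight (prefix_rows A) k p m c =
    (\<Sum>i = 1..k. int (\<Sum>r = i..p + i. \<Sum>u = c i (r - i)..c i (Suc r - i). A u r))"
proof -
  have "int (\<Sum>r = i..p + i. \<Sum>u = c i (r - i)..c i (Suc r - i). A u r) = prefix_rows A (p + i) m +
    (\<Sum>l = 1..p. prefix_rows A (i + l - 1) (c i l) - prefix_rows A (i + l) (c i l - 1))"
    if "i \<in> {1..k}" for i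
  proof -
    have "c i 0 = 1" "\<forall>l\<le>p. c i l \<le> c i (Suc l)" "c i (Suc p) = m"
      using assms that unfolding jump_array_def by auto
    then show ?thesis using rows_weight[of "c i" p A i] by simp
  qed
  then show ?thesis unfolding jump_weight_def by (simp add: sum.distrib)
qed

text \<open>
  Disjointness forces the order of the paths: they start in increasing rows of column 1, so in the first
  common row the upper path is on the left, and two disjoint intervals in a row keep their
  order from one row to the next.
\<close>

lemma path_tuple_jump_array:
  assumes \<pi>: "path_tuple m (k + p) k \<pi>" and k: "1 \<le> k"
  shows "\<exists>c. jump_array k p m c \<and>
    jump_weight (prefix_rows A) k p m c = int (\<Sum>i = 1..k. path_weight A (\<pi> i))"
proof -
  define rows where "rows i y \<longleftrightarrow> y i = 1 \<and> y (Suc (p + i)) = m \<and> (\<forall>r\<in>{i..p + i}. y r \<le> y (Suc r)) \<and>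
      set (\<pi> i) = {(u, r). i \<le> r \<and> r \<le> p + i \<and> y r \<le> u \<and> u \<le> y (Suc r)} \<and>
      path_weight A (\<pi> i) = (\<Sum>r = i..p + i. \<Sum>u = y r..y (Suc r). A u r)" for i y
  have "\<exists>y. rows i y" if "i \<in> {1..k}" for i
  proof -
    have "up_right_path (\<pi> i)" "connects (\<pi> i) (1, i) (m, p + i)"
      using \<pi> that unfolding path_tuple_def by auto
    from up_right_path_rows[OF this, of A] show ?thesis unfolding rows_def by blast
  qed
  then obtain y where y: "\<And>i. i \<in> {1..k} \<Longrightarrow> rows i (y i)" by metis
  have ends: "y i i = 1" "y i (Suc (p + i)) = m"
    and nondecreasing: "\<And>r. i \<le> r \<Longrightarrow> r \<le> p + i \<Longrightarrow> y i r \<le> y i (Suc r)"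
    and cells: "set (\<pi> i) = {(u, r). i \<le> r \<and> r \<le> p + i \<and> y i r \<le> u \<and> u \<le> y i (Suc r)}"
    and weight: "path_weight A (\<pi> i) = (\<Sum>r = i..p + i. \<Sum>u = y i r..y i (Suc r). A u r)"
    if "i \<in> {1..k}" for i
    using y[OF that] unfolding rows_def by simp_all
  have mono: "y i (i + l) \<le> y i (Suc (i + l))" if i: "i \<in> {1..k}" and "l \<le> p" for i l
    using nondecreasing[OF i] that by simp
  define c where "c i l = (if i = 0 then Suc m else if k < i then 0 else y i (i + l))" for i l
  have pos: "1 \<le> y i (i + l)" if "i \<in> {1..k}" "l \<le> Suc p" for i l
    using that(2)
  proof (induction l)
    case (Suc l)
    then show ?case using mono[OF that(1), of l] by simp
  qed (use ends[OF that(1)] in simp)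
  have le: "y i (i + l) \<le> m" if "i \<in> {1..k}" "l \<le> Suc p" for i l
    using that(2)
  proof (induction rule: inc_induct)
    case base
    show ?case using ends[OF that(1)] by (simp add: add.commute)
  next
    case (step l)
    then show ?case using mono[OF that(1), of l] by simp
  qed
  have apart: "y (Suc i) (Suc i + l) < y i (i + l)"
    if i: "1 \<le> i" "i < k" and l: "1 \<le> l" "l \<le> p" and left: "y (Suc i) (i + l) \<le> y i (i + l)" for i l
  proof (rule ccontr)
    assume "\<not> y (Suc i) (Suc i + l) < y i (i + l)"
    then have "y i (i + l) \<le> y (Suc i) (Suc (i + l))" by simp
    moreover have "y i (i + l) \<le> y i (Suc (i + l))" using mono i l by simp
    ultimately have "(y i (i + l), i + l) \<in> set (\<pi> i) \<inter> set (\<pi> (Suc i))"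
      using left l i unfolding Int_iff by (subst (1 2) cells) auto
    moreover have "set (\<pi> i) \<inter> set (\<pi> (Suc i)) = {}"
      using \<pi> i unfolding path_tuple_def by (metis atLeastAtMost_iff le_SucI less_imp_le n_not_Suc_n Suc_leI)
    ultimately show False by blast
  qed
  have strict: "y (Suc i) (Suc i + l) < y i (i + l)" if i: "1 \<le> i" "i < k" and l: "1 \<le> l" "l \<le> p" for i l
    using l
  proof (induction l rule: dec_induct)
    case base
    have "y (Suc i) (i + 1) \<le> y i (i + 1)" using ends(1)[of "Suc i"] pos[of i 1] i base by simp
    then show ?case using base i by (intro apart) auto
  next
    case (step l)
    have "y (Suc i) (Suc i + l) < y i (i + l)" using step by simp
    also have "\<dots> \<le> y i (i + Suc l)" using mono[of i l] step i by simp
    finally show ?case using step i by (intro apart) auto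
  qed
  have c: "jump_array k p m c"
    unfolding jump_array_def
  proof (intro conjI ballI allI impI)
    fix i assume i: "i \<in> {1..k}"
    show "c i 0 = 1" "c i (Suc p) = m" using ends[OF i] i by (auto simp: c_def add.commute)
    fix l assume "l \<le> p"
    then show "c i l \<le> c i (Suc l)" using mono[OF i] i by (simp add: c_def)
  next
    fix l assume l: "l \<in> {1..p}"
    show "c 0 l = Suc m" "c (Suc k) l = 0" by (auto simp: c_def)
    fix i assume i: "i \<le> k"
    consider "i = 0" | "i = k" "1 \<le> i" | "1 \<le> i" "i < k" using i by linarith
    then show "c (Suc i) l < c i l"
    proof cases
      case 1
      then show ?thesis using le[of 1 l] l k by (auto simp: c_def)
    next
      case 2
      then show ?thesis using pos[of i l] l by (auto simp: c_def)
    next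
      case 3
      then show ?thesis using strict[of i l] l by (auto simp: c_def)
    qed
  qed
  have "path_weight A (\<pi> i) = (\<Sum>r = i..p + i. \<Sum>u = c i (r - i)..c i (Suc r - i). A u r)"
    if "i \<in> {1..k}" for i
  proof -
    have "(\<Sum>r = i..p + i. \<Sum>u = c i (r - i)..c i (Suc r - i). A u r)
        = (\<Sum>r = i..p + i. \<Sum>u = y i r..y i (Suc r). A u r)"
      using that by (intro sum.cong refl) (auto simp: c_def)
    then show ?thesis unfolding weight[OF that] ..
  qed
  then show ?thesis
    using c jump_weight_eq_rows[OF c, of A] by (intro exI[of _ c]) simp
qed

lemma jump_array_path_tuple:
  assumes c: "jump_array k p m c"
  shows "\<exists>\<pi>. path_tuple m (k + p) k \<pi> \<and>
    jump_weight (prefix_rows A) k p m c = int (\<Sum>i = 1..k. path_weight A (\<pi> i))"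
proof -
  have row: "c i 0 = 1" "c i (Suc p) = m" "\<And>l. l \<le> p \<Longrightarrow> c i l \<le> c i (Suc l)" if "i \<in> {1..k}" for i
    using c that unfolding jump_array_def by auto
  define follows where "follows i q \<longleftrightarrow> up_right_path q \<and> connects q (1, i) (m, p + i) \<and>
      set q = {(u, r). i \<le> r \<and> r \<le> p + i \<and> c i (r - i) \<le> u \<and> u \<le> c i (Suc r - i)} \<and>
      path_weight A q = (\<Sum>r = i..p + i. \<Sum>u = c i (r - i)..c i (Suc r - i). A u r)" for i q
  have "\<exists>q. follows i q" if i: "i \<in> {1..k}" for i
  proof -
    have "\<forall>r\<in>{i..p + i}. c i (r - i) \<le> c i (Suc r - i)"
      using row(3)[OF i] by (auto simp: Suc_diff_le)
    moreover have "c i (i - i) = 1" "c i (Suc (p + i) - i) = m"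
      using row(1,2)[OF i] by (simp_all add: Suc_diff_le)
    ultimately show ?thesis
      using rows_up_right_path[of i "p + i" "\<lambda>r. c i (r - i)" A] unfolding follows_def by simp
  qed
  then obtain \<pi> where \<pi>: "\<And>i. i \<in> {1..k} \<Longrightarrow> follows i (\<pi> i)" by metis
  have path: "up_right_path (\<pi> i)" "connects (\<pi> i) (1, i) (m, p + i)"
    and cells: "set (\<pi> i) = {(u, r). i \<le> r \<and> r \<le> p + i \<and> c i (r - i) \<le> u \<and> u \<le> c i (Suc r - i)}"
    and weight: "path_weight A (\<pi> i) = (\<Sum>r = i..p + i. \<Sum>u = c i (r - i)..c i (Suc r - i). A u r)"
    if "i \<in> {1..k}" for i
    using \<pi>[OF that] unfolding follows_def by simp_all
  have strict: "c j l < c i l" if "i < j" "j \<le> k" "l \<in> {1..p}" for i j l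
    using that(1)
  proof (induction i rule: strict_inc_induct)
    case (base i)
    then show ?case using c that unfolding jump_array_def by auto
  next
    case (step i)
    then have "c (Suc i) l < c i l" using c that unfolding jump_array_def by auto
    then show ?case using step by simp
  qed
  have mono: "c i l \<le> c i l'" if "i \<in> {1..k}" "l \<le> l'" "l' \<le> Suc p" for i l l'
    using that(2,3)
  proof (induction l' rule: dec_induct)
    case (step l')
    then show ?case using row(3)[OF that(1), of l'] by simp
  qed simp
  have "set (\<pi> i) \<inter> set (\<pi> j) = {}" if ij: "i \<in> {1..k}" "j \<in> {1..k}" "i < j" for i j
  proof -
    have "c j (Suc r - j) < c i (r - i)" if "j \<le> r" "r \<le> p + i" for r
    proof -
      have "c j (Suc r - j) < c i (Suc r - j)" using that ij by (intro strict) auto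
      also have "\<dots> \<le> c i (r - i)" using that ij by (intro mono) auto
      finally show ?thesis .
    qed
    then have "\<not> (c i (r - i) \<le> u \<and> u \<le> c j (Suc r - j))" if "j \<le> r" "r \<le> p + i" for r u
      using that by (meson le_trans not_le)
    then show ?thesis unfolding cells[OF ij(1)] cells[OF ij(2)] by blast
  qed
  then have "set (\<pi> i) \<inter> set (\<pi> j) = {}" if "i \<in> {1..k}" "j \<in> {1..k}" "i \<noteq> j" for i j
    using that by (metis Int_commute linorder_neqE_nat)
  then have "path_tuple m (k + p) k \<pi>" using path by (simp add: path_tuple_def)
  moreover have "jump_weight (prefix_rows A) k p m c = int (\<Sum>i = 1..k. path_weight A (\<pi> i))"
    unfolding jump_weight_eq_rows[OF c] of_nat_sum by (intro sum.cong refl) (simp only: weight of_nat_sum)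
  ultimately show ?thesis by blast
qed

lemma last_passage_eq_shape:
  assumes "1 \<le> k" "k \<le> min m n"
  shows "int (last_passage A m n k) = (\<Sum>s<k. shape A m n s)"
proof -
  obtain p where n: "n = k + p" using assms by (metis le_iff_add min.bounded_iff)
  define S where "S = {(\<Sum>i = 1..k. path_weight A (\<pi> i)) | \<pi>. path_tuple m n k \<pi>}"
  define L where "L = (\<Sum>s<k. shape A m n s)"
  have k: "k \<le> m" using assms by simp
  have le: "int w \<le> L" if w: "w \<in> S" for w
  proof -
    obtain \<pi> where \<pi>: "path_tuple m n k \<pi>" "w = (\<Sum>i = 1..k. path_weight A (\<pi> i))"
      using w unfolding S_def by blast
    obtain c where c: "jump_array k p m c" "jump_weight (prefix_rows A) k p m c = int w"
      using path_tuple_jump_array[OF \<pi>(1)[unfolded n] assms(1), of A] \<pi>(2) by blast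
    show ?thesis using max_jump_weight(1)[OF assms(1) k, of p A] c unfolding L_def n by metis
  qed
  obtain c where c: "jump_array k p m c" "jump_weight (prefix_rows A) k p m c = L"
    using max_jump_weight(2)[OF assms(1) k, of p A] unfolding L_def n by blast
  obtain \<pi> where "path_tuple m n k \<pi>" "L = int (\<Sum>i = 1..k. path_weight A (\<pi> i))"
    using jump_array_path_tuple[OF c(1), of A] unfolding c(2) n by blast
  then obtain w where w: "w \<in> S" "int w = L" unfolding S_def by blast
  have "finite S" by (rule finite_subset[of _ "{..w}"]) (use le w in auto)
  then have "Max S = w" using w le by (intro Max_eqI) auto
  then show ?thesis using assms w by (simp add: last_passage_def S_def L_def)
qed

text \<open>
  For k > min(m,n) the last passage time is the sum of all entries, and so is the sum of all parts.
\<close>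

theorem lpp_shape_eq_shape: "lpp_shape A (m, n) (Suc k) = shape A m n k"
proof (cases "m = 0 \<or> n = 0")
  case False
  have total: "int (last_passage A m n k) = (\<Sum>s<k. shape A m n s)" if "1 \<le> k" for k
  proof (cases "k \<le> min m n")
    case False
    have "(\<Sum>s<k. shape A m n s) = (\<Sum>s<max k (max m n). shape A m n s)"
      using False by (intro sum.mono_neutral_left) (auto intro!: shape_vanishes)
    also have "\<dots> = (\<Sum>i = 1..m. \<Sum>j = 1..n. int (A i j))" by (rule sum_shape) auto
    finally have "(\<Sum>s<k. shape A m n s) = (\<Sum>i = 1..m. \<Sum>j = 1..n. int (A i j))" .
    moreover have "last_passage A m n k = (\<Sum>i = 1..m. \<Sum>j = 1..n. A i j)"
      using False by (simp only: last_passage_def if_False)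
    ultimately show ?thesis by simp
  qed (use that last_passage_eq_shape in blast)
  show ?thesis
    using False total[of k] total[of "Suc k"] by (cases k) (auto simp: lpp_shape_def)
qed (auto simp: lpp_shape_def)

section \<open>Weights of partitions and the inverse of the growth rule\<close>

definition part :: "(nat \<Rightarrow> int) \<Rightarrow> bool" where
  "part p \<longleftrightarrow> (\<forall>k. 0 \<le> p k \<and> p (Suc k) \<le> p k) \<and> (\<exists>K. \<forall>k\<ge>K. p k = 0)"

definition skew :: "(nat \<Rightarrow> int) \<Rightarrow> (nat \<Rightarrow> int) \<Rightarrow> real \<Rightarrow> real" where
  "skew p q x = (if interlaced p q then x ^ nat (\<Sum>k | p k \<noteq> q k. p k - q k) else 0)"

definition alternating :: "(nat \<Rightarrow> int) \<Rightarrow> real \<Rightarrow> real" where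
  "alternating p c = c ^ nat (\<Sum>k | p k \<noteq> 0. (- 1) ^ k * p k)"

lemma skew_schur_eq_skew: "skew_schur l \<mu> x = skew (\<lambda>k. l (Suc k)) (\<lambda>k. \<mu> (Suc k)) x"
proof -
  have all: "(\<forall>k\<ge>1. R k) \<longleftrightarrow> (\<forall>k. R (Suc k))" for R :: "nat \<Rightarrow> bool"
    by (metis One_nat_def Suc_le_D Suc_le_mono le0)
  have "interlaces l \<mu> \<longleftrightarrow> interlaced (\<lambda>k. l (Suc k)) (\<lambda>k. \<mu> (Suc k))"
    unfolding interlaces_def interlaced_def all by simp
  moreover have "(\<Sum>k \<in> {k. k \<ge> 1 \<and> l k \<noteq> \<mu> k}. l k - \<mu> k)
      = (\<Sum>k | l (Suc k) \<noteq> \<mu> (Suc k). l (Suc k) - \<mu> (Suc k))"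
    by (rule sum.reindex_bij_witness[of _ Suc "\<lambda>k. k - 1"]) auto
  ultimately show ?thesis by (simp add: skew_schur_def skew_def)
qed

lemma tau_eq_alternating: "tau l c = alternating (\<lambda>k. l (Suc k)) c"
proof -
  have "(\<Sum>k \<in> {k. k \<ge> 1 \<and> l k \<noteq> 0}. (- 1) ^ (k + 1) * l k) = (\<Sum>k | l (Suc k) \<noteq> 0. (- 1) ^ k * l (Suc k))"
    by (rule sum.reindex_bij_witness[of _ Suc "\<lambda>k. k - 1"]) (auto dest!: Suc_le_D)
  then show ?thesis by (simp add: tau_def alternating_def)
qed

lemma skew_eq_power:
  assumes "interlaced p q" "\<And>k. K \<le> k \<Longrightarrow> p k = q k"
  shows "skew p q x = x ^ nat ((\<Sum>k<K. p k) - (\<Sum>k<K. q k))"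
proof -
  have support: "k < K" if "p k \<noteq> q k" for k using assms(2)[of k] that by (meson not_less)
  have "(\<Sum>k | p k \<noteq> q k. p k - q k) = (\<Sum>k<K. p k - q k)"
    using support by (intro sum.mono_neutral_left) auto
  then show ?thesis using assms(1) by (simp add: skew_def sum_subtractf)
qed

lemma alternating_eq_power:
  assumes "\<And>k. K \<le> k \<Longrightarrow> p k = 0"
  shows "alternating p c = c ^ nat (\<Sum>k<K. (- 1) ^ k * p k)"
proof -
  have support: "k < K" if "p k \<noteq> 0" for k using assms[of k] that by (meson not_less)
  have "(\<Sum>k | p k \<noteq> 0. (- 1) ^ k * p k) = (\<Sum>k<K. (- 1) ^ k * p k)"
    using support by (intro sum.mono_neutral_left) auto
  then show ?thesis by (simp add: alternating_def)
qed

lemma grow_commute: "grow a b d w = grow b a d w"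
  by (auto simp: fun_eq_iff grow_def max.commute min.commute split: nat.split)

lemma grow_vanishes:
  assumes "\<And>k. K \<le> k \<Longrightarrow> a k = 0" "\<And>k. K \<le> k \<Longrightarrow> b k = 0" "\<And>k. K \<le> k \<Longrightarrow> d k = 0" "Suc K \<le> k"
  shows "grow a b d w k = 0"
proof -
  obtain i where "k = Suc i" "K \<le> i" using assms(4) by (metis Suc_le_D Suc_le_mono)
  then show ?thesis using assms(1-3)[of i] assms(1-3)[of "Suc i"] by simp
qed

lemma common_bound:
  assumes "part a" "part b" "part d"
  shows "\<exists>K. \<forall>k\<ge>K. a k = 0 \<and> b k = 0 \<and> d k = 0"
proof -
  obtain K1 K2 K3 where "\<forall>k\<ge>K1. a k = 0" "\<forall>k\<ge>K2. b k = 0" "\<forall>k\<ge>K3. d k = 0"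
    using assms unfolding part_def by blast
  then show ?thesis by (intro exI[of _ "max K1 (max K2 K3)"]) auto
qed

text \<open>
  This is the identity |l| + |d| = |a| + |b| + w for one growth step; a common bound K on the lengths turns
  the sizes into finite sums.
\<close>

lemma skew_grow:
  assumes "part a" "part b" "part d" "interlaced a d" "interlaced b d" "0 \<le> w"
  shows "skew (grow a b d w) a x = skew b d x * x ^ nat w"
proof -
  obtain K where "\<forall>k\<ge>K. a k = 0 \<and> b k = 0 \<and> d k = 0"
    using common_bound[OF assms(1-3)] by blast
  then have K: "\<And>k. K \<le> k \<Longrightarrow> a k = 0" "\<And>k. K \<le> k \<Longrightarrow> b k = 0" "\<And>k. K \<le> k \<Longrightarrow> d k = 0"
    by simp_all
  let ?l = "grow a b d w"
  define S where "S = (\<Sum>k<K. b k) - (\<Sum>k<K. d k)"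
  have "0 \<le> S"
    using assms(5) unfolding S_def interlaced_def by (simp add: sum_mono)
  have "(\<Sum>k<Suc K. ?l k) - (\<Sum>k<Suc K. a k) = w + S"
    unfolding sum_grow by (simp add: K S_def sum.distrib sum_subtractf)
  moreover have "skew ?l a x = x ^ nat ((\<Sum>k<Suc K. ?l k) - (\<Sum>k<Suc K. a k))"
  proof (rule skew_eq_power)
    show "interlaced ?l a" by (rule grow_interlaced[OF assms(4-6)])
    show "?l k = a k" if "Suc K \<le> k" for k
      using grow_vanishes[OF K that] K(1)[of k] that by simp
  qed
  moreover have "skew b d x = x ^ nat S"
    unfolding S_def by (rule skew_eq_power) (use assms(5) K in auto)
  ultimately show ?thesis using assms(6) \<open>0 \<le> S\<close> by (simp add: nat_add_distrib power_add)
qed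

text \<open>
  Bounding the alternating sum from above as well makes the induction on shifted sequences work. The
  lower bound ensures that converting exponents to natural numbers is additive.
\<close>

lemma alternating_sum_bounds:
  fixes p :: "nat \<Rightarrow> int"
  assumes "\<And>k. 0 \<le> p k \<and> p (Suc k) \<le> p k"
  shows "0 \<le> (\<Sum>k<K. (- 1) ^ k * p k) \<and> (\<Sum>k<K. (- 1) ^ k * p k) \<le> p 0"
  using assms
proof (induction K arbitrary: p)
  case (Suc K)
  have "(\<Sum>k<Suc K. (- 1) ^ k * p k) = p 0 - (\<Sum>k<K. (- 1) ^ k * p (Suc k))"
    by (subst sum.lessThan_Suc_shift) (simp add: sum_negf)
  moreover have "0 \<le> (\<Sum>k<K. (- 1) ^ k * p (Suc k)) \<and> (\<Sum>k<K. (- 1) ^ k * p (Suc k)) \<le> p (Suc 0)"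
    using Suc.prems by (intro Suc.IH) auto
  moreover have "p (Suc 0) \<le> p 0" using Suc.prems by auto
  ultimately show ?case by linarith
qed auto

text \<open>
  With a = b the rule reads l_k = b_k + b_{k-1} - d_{k-1}, and in the alternating sum the parts of b cancel.
\<close>

lemma alternating_grow:
  assumes "part b" "part d" "interlaced b d" "0 \<le> w"
  shows "alternating (grow b b d w) c = alternating d c * c ^ nat w"
proof -
  obtain K where "\<forall>k\<ge>K. b k = 0 \<and> b k = 0 \<and> d k = 0"
    using common_bound[OF assms(1,1,2)] by blast
  then have K: "\<And>k. K \<le> k \<Longrightarrow> b k = 0" "\<And>k. K \<le> k \<Longrightarrow> b k = 0" "\<And>k. K \<le> k \<Longrightarrow> d k = 0"
    by simp_all
  define S where "S = (\<Sum>k<K. (- 1) ^ k * d k)"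
  have "(\<Sum>k<Suc K. (- 1) ^ k * grow b b d w k) = w + (\<Sum>k<K. (- 1) ^ k * d k) + (- 1) ^ K * b K" for K
  proof (induction K)
    case (Suc K)
    have "(\<Sum>k<Suc (Suc K). (- 1) ^ k * grow b b d w k) =
        w + (\<Sum>k<K. (- 1) ^ k * d k) + (- 1) ^ K * b K + (- 1) ^ Suc K * (b (Suc K) + b K - d K)"
      by (subst sum.lessThan_Suc, subst Suc.IH) simp
    then show ?case by (simp add: right_diff_distrib distrib_left)
  qed simp
  from this[of K] have "(\<Sum>k<Suc K. (- 1) ^ k * grow b b d w k) = w + S"
    unfolding S_def K(1)[OF order_refl] by linarith
  moreover have "alternating (grow b b d w) c = c ^ nat (\<Sum>k<Suc K. (- 1) ^ k * grow b b d w k)"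
    by (rule alternating_eq_power) (rule grow_vanishes[OF K])
  moreover have "alternating d c = c ^ nat S"
    unfolding S_def by (rule alternating_eq_power) (rule K(3))
  moreover have "0 \<le> d k \<and> d (Suc k) \<le> d k" for k using assms(2) unfolding part_def by blast
  then have "0 \<le> S" unfolding S_def by (rule alternating_sum_bounds[THEN conjunct1])
  ultimately show ?thesis using assms(4) by (simp add: nat_add_distrib power_add)
qed

definition ungrow :: "(nat \<Rightarrow> int) \<Rightarrow> (nat \<Rightarrow> int) \<Rightarrow> (nat \<Rightarrow> int) \<Rightarrow> nat \<Rightarrow> int" where
  "ungrow a b l k = max (a (Suc k)) (b (Suc k)) + min (a k) (b k) - l (Suc k)"

lemma grow_eq_iff: "grow a b d w = l \<longleftrightarrow> d = ungrow a b l \<and> w = l 0 - max (a 0) (b 0)"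
proof
  assume "d = ungrow a b l \<and> w = l 0 - max (a 0) (b 0)"
  then show "grow a b d w = l"
    by (auto simp: fun_eq_iff grow_def ungrow_def split: nat.split)
qed (auto simp: ungrow_def)

text \<open>
  Interlacing places each part of l between max(a_{k+1},b_{k+1}) and min(a_k,b_k), and \<open>ungrow\<close> reflects
  that interval onto itself.
\<close>

lemma ungrow_interlaced:
  assumes "interlaced l a" "interlaced l b"
  shows "interlaced a (ungrow a b l)" "interlaced b (ungrow a b l)"
proof -
  have "max (a (Suc k)) (b (Suc k)) \<le> l (Suc k)" "l (Suc k) \<le> min (a k) (b k)" for k
    using assms by (auto simp: interlaced_def)
  then have "max (a (Suc k)) (b (Suc k)) \<le> ungrow a b l k \<and> ungrow a b l k \<le> min (a k) (b k)" for k
    unfolding ungrow_def by (metis add.commute add_le_imp_le_diff add_left_mono diff_le_eq)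
  then show "interlaced a (ungrow a b l)" "interlaced b (ungrow a b l)"
    unfolding interlaced_def by auto
qed

lemma part_interlaced:
  assumes "part a" "interlaced a d"
  shows "part d"
proof -
  obtain K where K: "\<forall>k\<ge>K. a k = 0" using assms by (auto simp: part_def)
  have a: "0 \<le> a k" "d k \<le> a k" "a (Suc k) \<le> d k" for k
    using assms unfolding part_def interlaced_def by auto
  have "0 \<le> d k \<and> d (Suc k) \<le> d k" for k
    using a(1)[of "Suc k"] a(3)[of k] a(2)[of "Suc k"] by linarith
  moreover have "d k = 0" if "K \<le> k" for k
    using that K a(2)[of k] a(1)[of "Suc k"] a(3)[of k] by simp
  ultimately show ?thesis unfolding part_def by blast
qed

section \<open>Partitions along a path determine the array\<close>

definition symm :: "(nat \<Rightarrow> nat \<Rightarrow> nat) \<Rightarrow> bool" where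
  "symm A \<longleftrightarrow> (\<forall>i\<ge>1. \<forall>j\<ge>1. A i j = A j i)"

lemma shape_symm: "symm A \<Longrightarrow> shape A m n = shape A n m"
proof (induction m n rule: shape.induct[of _ A])
  case (3 A m n)
  then show ?case by (simp add: symm_def) (rule grow_commute)
qed auto

text \<open>
  A down-right path from the diagonal to the axis visits the vertex (i + h(i), h(i)) after i steps,
  because each step increases the difference of the coordinates by one. So the path is encoded by its
  heights, and moving a corner changes a single value of h.
\<close>

definition staircase :: "nat \<Rightarrow> (nat \<Rightarrow> nat) \<Rightarrow> bool" where
  "staircase T h \<longleftrightarrow> h T = 0 \<and> (\<forall>i<T. h (Suc i) = h i \<or> Suc (h (Suc i)) = h i)"

definition fits :: "(nat \<Rightarrow> nat \<Rightarrow> nat) \<Rightarrow> nat \<Rightarrow> (nat \<Rightarrow> nat) \<Rightarrow> (nat \<Rightarrow> nat \<Rightarrow> int) \<Rightarrow> bool" where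
  "fits A T h \<Lambda> \<longleftrightarrow> (\<forall>i\<le>T. shape A (i + h i) (h i) = \<Lambda> i)"

definition step_weight :: "(nat \<Rightarrow> real) \<Rightarrow> (nat \<Rightarrow> nat) \<Rightarrow> (nat \<Rightarrow> nat \<Rightarrow> int) \<Rightarrow> nat \<Rightarrow> real" where
  "step_weight x h \<Lambda> i =
     (if h (Suc i) = h i then skew (\<Lambda> (Suc i)) (\<Lambda> i) (x (Suc (i + h i)))
      else skew (\<Lambda> i) (\<Lambda> (Suc i)) (x (h i)))"

definition staircase_weight ::
  "(nat \<Rightarrow> real) \<Rightarrow> real \<Rightarrow> nat \<Rightarrow> (nat \<Rightarrow> nat) \<Rightarrow> (nat \<Rightarrow> nat \<Rightarrow> int) \<Rightarrow> real" where
  "staircase_weight x c T h \<Lambda> =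
     alternating (\<Lambda> 0) c * (if \<Lambda> T = (\<lambda>_. 0) then 1 else 0) * (\<Prod>i<T. step_weight x h \<Lambda> i)"

text \<open>
  The parameter of the geometric variable at (i+j,j), where i is the distance from the diagonal.
\<close>

definition rate :: "(nat \<Rightarrow> real) \<Rightarrow> real \<Rightarrow> nat \<Rightarrow> nat \<Rightarrow> real" where
  "rate x c i j = (if i = 0 then c * x j else x (i + j) * x j)"

lemma staircase_antimono:
  assumes "staircase T h" "i \<le> j" "j \<le> T"
  shows "h j \<le> h i"
  using assms(2,3)
proof (induction j rule: dec_induct)
  case (step j)
  then have "h (Suc j) \<le> h j" using assms(1) unfolding staircase_def by (metis Suc_le_lessD le_Suc_eq order_refl)
  then show ?case using step by simp
qed simp

text \<open>
  The corner is at the end of the initial horizontal run; the run may be empty, and then the corner is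
  the starting point on the diagonal.
\<close>

lemma staircase_corner:
  assumes h: "staircase T h" and pos: "0 < h 0"
  obtains i n where "i < T" "h i = Suc n" "h (Suc i) = n" "i = 0 \<or> h (i - 1) = Suc n"
proof -
  define i where "i = (LEAST t. h (Suc t) \<noteq> h 0)"
  obtain T' where T: "T = Suc T'" "h (Suc T') = 0"
    using h pos unfolding staircase_def by (cases T) auto
  have ex: "h (Suc T') \<noteq> h 0" using T pos by simp
  have drop: "h (Suc i) \<noteq> h 0" unfolding i_def by (rule LeastI[of "\<lambda>t. h (Suc t) \<noteq> h 0", OF ex])
  have level: "h (Suc t) = h 0" if "t < i" for t
    using not_less_Least[of t "\<lambda>t. h (Suc t) \<noteq> h 0"] that unfolding i_def by blast
  have "i \<le> T'" unfolding i_def by (rule Least_le[of "\<lambda>t. h (Suc t) \<noteq> h 0", OF ex])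
  then have iT: "i < T" using T by simp
  have hi: "h i = h 0" using level[of "i - 1"] by (cases i) auto
  have "Suc (h (Suc i)) = h i" using h iT drop hi unfolding staircase_def by metis
  moreover have "i = 0 \<or> h (i - 1) = h i" using level[of "i - 2"] hi by (cases i; cases "i - 1") auto
  ultimately show ?thesis using that[of i "h (Suc i)"] iT by metis
qed

lemma staircase_flip:
  assumes "staircase T h" "i < T" "h i = Suc n" "h (Suc i) = n" "i = 0 \<or> h (i - 1) = Suc n"
  shows "staircase T (h(i := n))"
  unfolding staircase_def
proof (intro conjI allI impI)
  show "(h(i := n)) T = 0" using assms unfolding staircase_def by auto
  fix t assume "t < T"
  then have "h (Suc t) = h t \<or> Suc (h (Suc t)) = h t" using assms(1) unfolding staircase_def by blast
  moreover have "Suc t = i \<Longrightarrow> h t = Suc n" using assms(5) by auto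
  ultimately show "(h(i := n)) (Suc t) = (h(i := n)) t \<or> Suc ((h(i := n)) (Suc t)) = (h(i := n)) t"
    using assms(3,4) by (cases "t = i"; cases "Suc t = i") auto
qed

text \<open>
  The partition to the left of the corner is that of the previous vertex; at a corner on the diagonal,
  by symmetry, it agrees with the partition below the corner. This is the choice made for a.
\<close>

lemma fits_flip:
  fixes \<Lambda> :: "nat \<Rightarrow> nat \<Rightarrow> int"
  assumes h: "i < T" "h i = Suc n" "h (Suc i) = n" "i = 0 \<or> h (i - 1) = Suc n"
    and A: "symm A"
  defines "a \<equiv> \<Lambda> (if i = 0 then 1 else i - 1)" and "b \<equiv> \<Lambda> (Suc i)" and "l \<equiv> \<Lambda> i"
  shows "fits A T h \<Lambda> \<Longrightarrow> interlaced l a \<and> interlaced l b"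
    and "interlaced l a \<Longrightarrow> interlaced l b \<Longrightarrow>
      fits A T h \<Lambda> \<longleftrightarrow>
      fits A T (h(i := n)) (\<Lambda>(i := ungrow a b l)) \<and> A (i + Suc n) (Suc n) = nat (l 0 - max (a 0) (b 0))"
proof -
  define rest where "rest \<longleftrightarrow> (\<forall>t\<le>T. t \<noteq> i \<longrightarrow> shape A (t + h t) (h t) = \<Lambda> t)"
  have old: "fits A T h \<Lambda> \<longleftrightarrow> rest \<and> shape A (Suc (i + n)) (Suc n) = l"
    using h(1,2) unfolding fits_def rest_def l_def by (metis add_Suc_right less_imp_le)
  have new: "fits A T (h(i := n)) (\<Lambda>(i := d)) \<longleftrightarrow> rest \<and> shape A (i + n) n = d" for d
    using h(1) unfolding fits_def rest_def by (auto simp: less_imp_le)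
  have sides: "shape A (i + n) (Suc n) = a \<and> shape A (Suc (i + n)) n = b" if rest
  proof
    have "shape A (Suc i + h (Suc i)) (h (Suc i)) = \<Lambda> (Suc i)"
      using that h(1) unfolding rest_def by (metis Suc_leI n_not_Suc_n)
    then show b: "shape A (Suc (i + n)) n = b" using h(3) by (simp add: b_def)
    show "shape A (i + n) (Suc n) = a"
    proof (cases "i = 0")
      case True
      then show ?thesis using b shape_symm[OF A, of n "Suc n"] by (simp add: a_def b_def)
    next
      case False
      have "shape A (i - 1 + h (i - 1)) (h (i - 1)) = \<Lambda> (i - 1)"
        by (rule that[unfolded rest_def, rule_format]) (use h(1) False in auto)
      moreover have "i - 1 + h (i - 1) = i + n" "h (i - 1) = Suc n" using h(4) False by auto
      ultimately show ?thesis using False by (simp add: a_def)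
    qed
  qed
  show "interlaced l a \<and> interlaced l b" if "fits A T h \<Lambda>"
    using that shape_interlaced[of A "i + n" "Suc n"] shape_interlaced[of A "Suc (i + n)" n] sides
    unfolding old by metis
  assume l: "interlaced l a" "interlaced l b"
  have "max (a 0) (b 0) \<le> l 0" using l by (simp add: interlaced_def)
  then have w: "int v = l 0 - max (a 0) (b 0) \<longleftrightarrow> v = nat (l 0 - max (a 0) (b 0))" for v by auto
  have "shape A (Suc (i + n)) (Suc n) = l \<longleftrightarrow>
      shape A (i + n) n = ungrow a b l \<and> A (i + Suc n) (Suc n) = nat (l 0 - max (a 0) (b 0))" if rest
    unfolding shape.simps sides[OF that, THEN conjunct1] sides[OF that, THEN conjunct2] grow_eq_iff w
    by simp
  then show "fits A T h \<Lambda> \<longleftrightarrow>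
      fits A T (h(i := n)) (\<Lambda>(i := ungrow a b l)) \<and> A (i + Suc n) (Suc n) = nat (l 0 - max (a 0) (b 0))"
    unfolding old new by blast
qed

text \<open>
  At an inner corner the two adjacent steps trade x_{i+n+1}^w x_{n+1}^w. On the diagonal only
  one step is adjacent, contributing x_{n+1}^w, and the factor c^w comes from the alternating sum.
\<close>

lemma staircase_weight_flip:
  fixes \<Lambda> :: "nat \<Rightarrow> nat \<Rightarrow> int"
  assumes h: "i < T" "h i = Suc n" "h (Suc i) = n" "i = 0 \<or> h (i - 1) = Suc n"
    and parts: "\<And>t. t \<le> T \<Longrightarrow> part (\<Lambda> t)"
  defines "a \<equiv> \<Lambda> (if i = 0 then 1 else i - 1)" and "b \<equiv> \<Lambda> (Suc i)" and "l \<equiv> \<Lambda> i"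
  shows "staircase_weight x c T h \<Lambda> \<noteq> 0 \<Longrightarrow> interlaced l a \<and> interlaced l b"
    and "interlaced l a \<Longrightarrow> interlaced l b \<Longrightarrow>
      staircase_weight x c T h \<Lambda> = staircase_weight x c T (h(i := n)) (\<Lambda>(i := ungrow a b l)) *
        rate x c i (Suc n) ^ nat (l 0 - max (a 0) (b 0))"
proof -
  have step_i: "step_weight x h \<Lambda> i = skew l b (x (Suc n))"
    using h by (simp add: step_weight_def l_def b_def)
  have step_before: "step_weight x h \<Lambda> (i - 1) = skew l a (x (i + Suc n))" if "i \<noteq> 0"
    using h that by (auto simp: step_weight_def l_def a_def)
  show "interlaced l a \<and> interlaced l b" if nz: "staircase_weight x c T h \<Lambda> \<noteq> 0"
  proof -
    have "\<forall>t\<in>{..<T}. step_weight x h \<Lambda> t \<noteq> 0"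
      using nz unfolding staircase_weight_def by (simp add: prod_zero_iff)
    then have "step_weight x h \<Lambda> i \<noteq> 0" "step_weight x h \<Lambda> (i - 1) \<noteq> 0" using h(1) by auto
    then have "interlaced l b" "i \<noteq> 0 \<Longrightarrow> interlaced l a"
      using step_i step_before by (auto simp: skew_def split: if_splits)
    then show ?thesis by (auto simp: a_def b_def)
  qed
  assume l: "interlaced l a" "interlaced l b"
  define d where "d = ungrow a b l"
  define w where "w = l 0 - max (a 0) (b 0)"
  have w0: "0 \<le> w" using l by (simp add: w_def interlaced_def)
  have d: "interlaced a d" "interlaced b d" using ungrow_interlaced[OF l] by (simp_all add: d_def)
  have ab: "part a" "part b" using parts h(1) by (auto simp: a_def b_def)
  have pd: "part d" by (rule part_interlaced[OF ab(1) d(1)])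
  have grow: "grow a b d w = l" "grow b a d w = l"
    by (simp_all add: grow_eq_iff d_def w_def grow_commute[of b a])
  have la: "skew l a y = skew b d y * y ^ nat w" and lb: "skew l b y = skew a d y * y ^ nat w" for y
    using skew_grow[OF ab pd d w0, of y] skew_grow[OF ab(2,1) pd d(2,1) w0, of y] by (simp_all add: grow)
  let ?h = "h(i := n)" and ?\<Lambda> = "\<Lambda>(i := d)"
  have new_i: "step_weight x ?h ?\<Lambda> i = skew b d (x (i + Suc n))"
    using h by (simp add: step_weight_def b_def)
  have new_before: "step_weight x ?h ?\<Lambda> (i - 1) = skew a d (x (Suc n))" if "i \<noteq> 0"
    using h that by (auto simp: step_weight_def a_def)
  have unchanged: "step_weight x ?h ?\<Lambda> t = step_weight x h \<Lambda> t" if "t \<noteq> i" "Suc t \<noteq> i" for t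
    using that by (simp add: step_weight_def)
  have last: "(if ?\<Lambda> T = (\<lambda>_. 0) then 1 else 0 :: real) = (if \<Lambda> T = (\<lambda>_. 0) then 1 else 0)"
    using h(1) by simp
  have split_i: "(\<Prod>t<T. f t) = f i * (\<Prod>t\<in>{..<T} - {i}. f t)" for f :: "nat \<Rightarrow> real"
    using h(1) by (intro prod.remove) auto
  show "staircase_weight x c T h \<Lambda> = staircase_weight x c T (h(i := n)) (\<Lambda>(i := ungrow a b l)) *
        rate x c i (Suc n) ^ nat (l 0 - max (a 0) (b 0))"
  proof (cases "i = 0")
    case True
    have "a = b" using True by (simp add: a_def b_def)
    then have "alternating l c = alternating d c * c ^ nat w"
      using alternating_grow[OF ab(2) pd d(2) w0, of c] grow by simp
    moreover have "(\<Prod>t\<in>{..<T} - {i}. step_weight x ?h ?\<Lambda> t) = (\<Prod>t\<in>{..<T} - {i}. step_weight x h \<Lambda> t)"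
      using True by (intro prod.cong refl unchanged) auto
    moreover have "skew l b (x (Suc n)) = skew b d (x (Suc n)) * x (Suc n) ^ nat w"
      using la \<open>a = b\<close> by simp
    ultimately show ?thesis
      unfolding d_def[symmetric] w_def[symmetric] staircase_weight_def split_i last step_i new_i
      using True by (simp add: rate_def l_def power_mult_distrib)
  next
    case False
    have split: "(\<Prod>t<T. f t) = f i * (f (i - 1) * (\<Prod>t\<in>{..<T} - {i} - {i - 1}. f t))" for f :: "nat \<Rightarrow> real"
    proof -
      have "(\<Prod>t\<in>{..<T} - {i}. f t) = f (i - 1) * (\<Prod>t\<in>{..<T} - {i} - {i - 1}. f t)"
        using h(1) False by (intro prod.remove) auto
      then show ?thesis by (simp only: split_i)
    qed
    have "(\<Prod>t\<in>{..<T} - {i} - {i - 1}. step_weight x ?h ?\<Lambda> t)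
        = (\<Prod>t\<in>{..<T} - {i} - {i - 1}. step_weight x h \<Lambda> t)"
      using False by (intro prod.cong refl unchanged) auto
    then show ?thesis
      unfolding d_def[symmetric] w_def[symmetric] staircase_weight_def split last step_i new_i
        step_before[OF False] new_before[OF False] la lb
      using False by (simp add: rate_def power_mult_distrib)
  qed
qed

definition encodes :: "(nat \<Rightarrow> real) \<Rightarrow> real \<Rightarrow> nat \<Rightarrow> (nat \<Rightarrow> nat) \<Rightarrow> (nat \<Rightarrow> nat \<Rightarrow> int) \<Rightarrow>
    (nat \<Rightarrow> nat \<Rightarrow> nat) \<Rightarrow> bool" where
  "encodes x c T h \<Lambda> w \<longleftrightarrow>
     (\<forall>A. symm A \<longrightarrow> (fits A T h \<Lambda> \<longleftrightarrow> (\<forall>i\<le>T. \<forall>j\<in>{1..h i}. A (i + j) j = w i j))) \<and>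
     staircase_weight x c T h \<Lambda> = (\<Prod>i\<le>T. \<Prod>j = 1..h i. rate x c i j ^ w i j)"

text \<open>
  Induction on the area under the path, removing one box at a time. With no box left, all partitions have to
  be empty: the last one is prescribed to be so, and the remaining steps only increase.
\<close>

theorem staircase_bijection:
  assumes "staircase T h" "\<And>i. i \<le> T \<Longrightarrow> part (\<Lambda> i)"
  shows "(\<exists>w. encodes x c T h \<Lambda> w) \<or>
    ((\<forall>A. symm A \<longrightarrow> \<not> fits A T h \<Lambda>) \<and> staircase_weight x c T h \<Lambda> = 0)"
  using assms
proof (induction "\<Sum>i\<le>T. h i" arbitrary: h \<Lambda> rule: less_induct)
  case less
  show ?case
  proof (cases "h 0 = 0")
    case True
    have h0: "h i = 0" if "i \<le> T" for i
      using staircase_antimono[OF less.prems(1) _ that, of 0] True by simp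
    have fits: "fits A T h \<Lambda> \<longleftrightarrow> (\<forall>i\<le>T. \<Lambda> i = (\<lambda>_. 0))" for A
      using h0 by (auto simp: fits_def)
    have zero: "\<Lambda> i = (\<lambda>_. 0)" if nz: "staircase_weight x c T h \<Lambda> \<noteq> 0" and "i \<le> T" for i
      using that(2)
    proof (induction rule: inc_induct)
      case base
      then show ?case using nz by (auto simp: staircase_weight_def split: if_splits)
    next
      case (step i)
      have "step_weight x h \<Lambda> i \<noteq> 0"
        using nz step by (auto simp: staircase_weight_def prod_zero_iff)
      then have "interlaced (\<Lambda> (Suc i)) (\<Lambda> i)"
        using h0 step by (auto simp: step_weight_def skew_def split: if_splits)
      then have "\<Lambda> i k \<le> 0" for k using step by (auto simp: interlaced_def)
      moreover have "0 \<le> \<Lambda> i k" for k using less.prems(2)[of i] step by (auto simp: part_def)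
      ultimately show ?case by (auto simp: fun_eq_iff intro: order_antisym)
    qed
    show ?thesis
    proof (cases "\<forall>i\<le>T. \<Lambda> i = (\<lambda>_. 0)")
      case all: True
      have "staircase_weight x c T h \<Lambda> = 1"
        using all h0 by (simp add: staircase_weight_def alternating_def step_weight_def skew_def interlaced_def)
      then have "encodes x c T h \<Lambda> (\<lambda>_ _. 0)"
        using all h0 by (simp add: encodes_def fits)
      then show ?thesis by blast
    next
      case False
      then show ?thesis using zero fits by blast
    qed
  next
    case False
    then obtain i n where i: "i < T" "h i = Suc n" "h (Suc i) = n" "i = 0 \<or> h (i - 1) = Suc n"
      using staircase_corner[OF less.prems(1)] by blast
    define a where "a = \<Lambda> (if i = 0 then 1 else i - 1)"
    define b where "b = \<Lambda> (Suc i)"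
    define l where "l = \<Lambda> i"
    define d where "d = ungrow a b l"
    define v where "v = nat (l 0 - max (a 0) (b 0))"
    note flip = fits_flip[where h = h and \<Lambda> = \<Lambda>, OF i, folded a_def b_def l_def, folded d_def v_def]
    note weight = staircase_weight_flip[where h = h and \<Lambda> = \<Lambda> and x = x and c = c, OF i less.prems(2),
        folded a_def b_def l_def, folded d_def v_def]
    show ?thesis
    proof (cases "interlaced l a \<and> interlaced l b")
      case False
      then show ?thesis using flip(1) weight(1) by blast
    next
      case True
      let ?h = "h(i := n)" and ?\<Lambda> = "\<Lambda>(i := d)"
      have smaller: "(\<Sum>t\<le>T. ?h t) < (\<Sum>t\<le>T. h t)"
        using i by (intro sum_strict_mono_ex1) auto
      have stairs: "staircase T ?h" by (rule staircase_flip[OF less.prems(1) i])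
      have "part a" using less.prems(2) i(1) by (auto simp: a_def)
      moreover have "interlaced a d" using True ungrow_interlaced(1) unfolding d_def by blast
      ultimately have "part d" by (rule part_interlaced)
      then have parts: "part (?\<Lambda> t)" if "t \<le> T" for t using less.prems(2) that by auto
      have fits_iff: "fits A T h \<Lambda> \<longleftrightarrow> fits A T ?h ?\<Lambda> \<and> A (i + Suc n) (Suc n) = v" if "symm A" for A
        using flip(2)[OF that] True by blast
      have weight_eq: "staircase_weight x c T h \<Lambda> = staircase_weight x c T ?h ?\<Lambda> * rate x c i (Suc n) ^ v"
        using weight(2) True by blast
      consider w where "encodes x c T ?h ?\<Lambda> w"
        | "\<forall>A. symm A \<longrightarrow> \<not> fits A T ?h ?\<Lambda>" "staircase_weight x c T ?h ?\<Lambda> = 0"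
        using less.hyps[of ?h ?\<Lambda>, OF smaller stairs parts] by blast
      then show ?thesis
      proof cases
        case 1
        define w' where "w' = w(i := (w i)(Suc n := v))"
        have w'_i: "w' i (Suc n) = v" by (simp add: w'_def)
        have w'_other: "w' t j = w t j" if "j \<in> {1..?h t}" for t j
          using that by (auto simp: w'_def)
        have cells: "(\<forall>t\<le>T. \<forall>j\<in>{1..h t}. R t j) \<longleftrightarrow> (\<forall>t\<le>T. \<forall>j\<in>{1..?h t}. R t j) \<and> R i (Suc n)" for R
        proof
          assume R: "(\<forall>t\<le>T. \<forall>j\<in>{1..?h t}. R t j) \<and> R i (Suc n)"
          show "\<forall>t\<le>T. \<forall>j\<in>{1..h t}. R t j"
          proof (intro allI impI ballI)
            fix t j assume t: "t \<le> T" and "j \<in> {1..h t}"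
            then have "t = i \<and> j = Suc n \<or> j \<in> {1..?h t}" using i(2) by auto
            then show "R t j" using R t by blast
          qed
        next
          assume R: "\<forall>t\<le>T. \<forall>j\<in>{1..h t}. R t j"
          have "R i (Suc n)" using R i(1,2) by auto
          moreover have "{1..?h t} \<subseteq> {1..h t}" for t using i(2) by auto
          ultimately show "(\<forall>t\<le>T. \<forall>j\<in>{1..?h t}. R t j) \<and> R i (Suc n)" using R by blast
        qed
        have product: "(\<Prod>t\<le>T. \<Prod>j = 1..h t. f t j) = (\<Prod>t\<le>T. \<Prod>j = 1..?h t. f t j) * f i (Suc n)"
          for f :: "nat \<Rightarrow> nat \<Rightarrow> real"
        proof -
          have "(\<Prod>t\<in>{..T} - {i}. \<Prod>j = 1..?h t. f t j) = (\<Prod>t\<in>{..T} - {i}. \<Prod>j = 1..h t. f t j)"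
            by (intro prod.cong refl) auto
          moreover have "(\<Prod>t\<le>T. g t) = g i * (\<Prod>t\<in>{..T} - {i}. g t)" for g :: "nat \<Rightarrow> real"
            using i(1) by (intro prod.remove) auto
          ultimately show ?thesis using i(2) by simp
        qed
        have "encodes x c T h \<Lambda> w'"
          unfolding encodes_def
        proof (intro conjI allI impI)
          fix A assume A: "symm A"
          have "(\<forall>t\<le>T. \<forall>j\<in>{1..?h t}. A (t + j) j = w' t j) \<longleftrightarrow> (\<forall>t\<le>T. \<forall>j\<in>{1..?h t}. A (t + j) j = w t j)"
            using w'_other by metis
          then show "fits A T h \<Lambda> \<longleftrightarrow> (\<forall>t\<le>T. \<forall>j\<in>{1..h t}. A (t + j) j = w' t j)"
            unfolding cells[of "\<lambda>t j. A (t + j) j = w' t j"] fits_iff[OF A] w'_i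
            using 1 A unfolding encodes_def by blast
        next
          have "(\<Prod>t\<le>T. \<Prod>j = 1..?h t. rate x c t j ^ w' t j) = (\<Prod>t\<le>T. \<Prod>j = 1..?h t. rate x c t j ^ w t j)"
            by (intro prod.cong refl) (simp only: w'_other)
          then show "staircase_weight x c T h \<Lambda> = (\<Prod>t\<le>T. \<Prod>j = 1..h t. rate x c t j ^ w' t j)"
            unfolding product[of "\<lambda>t j. rate x c t j ^ w' t j"] weight_eq w'_i
            using 1 unfolding encodes_def by simp
        qed
        then show ?thesis by blast
      next
        case 2
        then show ?thesis using fits_iff weight_eq by simp
      qed
    qed
  qed
qed

section \<open>The joint law along a down-right path\<close>

lemma down_right_path_heights:
  assumes "down_right_path \<gamma>" "length \<gamma> = T + 1" "\<gamma> ! 0 = (N, N)" "\<gamma> ! T = (T, 0)"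
  defines "h \<equiv> \<lambda>i. snd (\<gamma> ! i)"
  shows "i \<le> T \<Longrightarrow> \<gamma> ! i = (i + h i, h i)" and "staircase T h"
    and "i < T \<Longrightarrow> path_word \<gamma> ! i = (if h (Suc i) = h i then StepR else StepD)"
proof -
  have snd: "snd (\<gamma> ! i) = h i" for i by (simp add: h_def)
  have step: "(fst (\<gamma> ! Suc i) = fst (\<gamma> ! i) \<and> Suc (h (Suc i)) = h i) \<or>
      (fst (\<gamma> ! Suc i) = fst (\<gamma> ! i) + 1 \<and> h (Suc i) = h i)" if "i < T" for i
  proof -
    have "Suc i < length \<gamma>" using that assms(2) by simp
    then have "(fst (\<gamma> ! Suc i) = fst (\<gamma> ! i) \<and> snd (\<gamma> ! Suc i) + 1 = snd (\<gamma> ! i)) \<or>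
        \<gamma> ! Suc i = (fst (\<gamma> ! i) + 1, snd (\<gamma> ! i))"
      using successively_conv_nth[THEN iffD1, OF assms(1)[unfolded down_right_path_def]] by blast
    then show ?thesis unfolding prod_eq_iff by (simp add: snd)
  qed
  have column: "fst (\<gamma> ! i) = i + h i" if "i \<le> T" for i
    using that
  proof (induction i)
    case 0
    then show ?case using assms(3) by (simp add: h_def)
  next
    case (Suc i)
    then show ?case using step[of i] by auto
  qed
  show "\<gamma> ! i = (i + h i, h i)" if "i \<le> T" for i
    using column[OF that] snd[of i] by (simp add: prod_eq_iff)
  have dichotomy: "h (Suc i) = h i \<or> Suc (h (Suc i)) = h i" if "i < T" for i
    using step[OF that] by blast
  then show "staircase T h" using assms(4) by (simp add: staircase_def h_def)
  show "path_word \<gamma> ! i = (if h (Suc i) = h i then StepR else StepD)" if i: "i < T"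
  proof -
    have "path_word \<gamma> ! i = (if fst (\<gamma> ! Suc i) = fst (\<gamma> ! i) \<and> Suc (h (Suc i)) = h i then StepD else StepR)"
      using i assms(2) by (simp add: path_word_def nth_tl h_def)
    moreover have "fst (\<gamma> ! Suc i) = Suc i + h (Suc i)" "fst (\<gamma> ! i) = i + h i"
      using column[of i] column[of "Suc i"] i by simp_all
    ultimately show ?thesis using dichotomy[OF i] by auto
  qed
qed

text \<open>
  Descending diagonally from the vertex at distance i from the diagonal reaches the points (i+j,j) with
  j \<le> h(i).
\<close>

lemma Y_less_heights:
  assumes "length \<gamma> = T + 1" "\<And>i. i \<le> T \<Longrightarrow> \<gamma> ! i = (i + h i, h i)"
  shows "Y_less \<gamma> = (\<lambda>(i, j). (i + j, j)) ` (SIGMA i:{1..T}. {1..h i})"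
proof (intro set_eqI iffI)
  fix v assume v: "v \<in> Y_less \<gamma>"
  obtain a b where ab: "v = (a, b)" by (cases v)
  obtain d where d: "1 \<le> b" "b < a" "(a + d, b + d) \<in> set \<gamma>"
    using v unfolding Y_less_def Y_set_def ab by blast
  then obtain i where "i < length \<gamma>" "\<gamma> ! i = (a + d, b + d)" by (auto simp: in_set_conv_nth)
  then have i: "i \<le> T" "i + h i = a + d" "h i = b + d" using assms(1) assms(2)[of i] by auto
  then have "v = (\<lambda>(i, j). (i + j, j)) (i, b)" "(i, b) \<in> (SIGMA i:{1..T}. {1..h i})"
    using d ab by auto
  then show "v \<in> (\<lambda>(i, j). (i + j, j)) ` (SIGMA i:{1..T}. {1..h i})" by blast
next
  fix v assume "v \<in> (\<lambda>(i, j). (i + j, j)) ` (SIGMA i:{1..T}. {1..h i})"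
  then obtain i j where ij: "v = (i + j, j)" "1 \<le> i" "i \<le> T" "1 \<le> j" "j \<le> h i" by auto
  have "\<gamma> ! i \<in> set \<gamma>" using ij assms(1) by (intro nth_mem) auto
  moreover have "\<gamma> ! i = (i + j + (h i - j), j + (h i - j))" using assms(2)[OF ij(3)] ij by simp
  ultimately have "(i + j + (h i - j), j + (h i - j)) \<in> set \<gamma>" by simp
  then have "\<exists>d. (i + j + d, j + d) \<in> set \<gamma>" by blast
  then show "v \<in> Y_less \<gamma>" using ij unfolding Y_less_def Y_set_def by simp
qed

lemma norm_const_heights:
  assumes "length \<gamma> = T + 1" "\<And>i. i \<le> T \<Longrightarrow> \<gamma> ! i = (i + h i, h i)"
  shows "norm_const x c (h 0) \<gamma> = (\<Prod>i\<le>T. \<Prod>j = 1..h i. 1 - rate x c i j)"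
proof -
  have "(\<Prod>(a, b)\<in>Y_less \<gamma>. 1 - x a * x b) = (\<Prod>(i, j)\<in>(SIGMA i:{1..T}. {1..h i}). 1 - x (i + j) * x j)"
  proof -
    have inj: "inj_on (\<lambda>(i, j). (i + j, j)) (SIGMA i:{1..T}. {1..h i})" by (auto simp: inj_on_def)
    have Y: "Y_less \<gamma> = (\<lambda>(i, j). (i + j, j)) ` (SIGMA i:{1..T}. {1..h i})"
      by (rule Y_less_heights) (use assms in auto)
    show ?thesis unfolding Y prod.reindex[OF inj] by (intro prod.cong refl) auto
  qed
  also have "\<dots> = (\<Prod>i = 1..T. \<Prod>j = 1..h i. 1 - x (i + j) * x j)"
    by (subst prod.Sigma) auto
  also have "\<dots> = (\<Prod>i = 1..T. \<Prod>j = 1..h i. 1 - rate x c i j)"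
    by (intro prod.cong refl) (auto simp: rate_def)
  finally have strict: "(\<Prod>(a, b)\<in>Y_less \<gamma>. 1 - x a * x b) = (\<Prod>i = 1..T. \<Prod>j = 1..h i. 1 - rate x c i j)" .
  have "(\<Prod>i\<le>T. \<Prod>j = 1..h i. 1 - rate x c i j) =
      (\<Prod>j = 1..h 0. 1 - rate x c 0 j) * (\<Prod>i\<in>{..T} - {0}. \<Prod>j = 1..h i. 1 - rate x c i j)"
    by (intro prod.remove) auto
  moreover have "{..T} - {0} = {1..T}" by auto
  ultimately show ?thesis unfolding norm_const_def strict by (simp add: rate_def)
qed

text \<open>
  Independence is given for indices (a,b) with a \<le> b, so the cells below the diagonal enter through their mirror images.
\<close>

lemma (in prob_space) geometric_cells:
  fixes w :: "nat \<Rightarrow> nat \<Rightarrow> nat"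
  assumes indep: "indep_vars (\<lambda>_. count_space UNIV) (\<lambda>(i, j). W i j) {(i, j). 1 \<le> i \<and> i \<le> j}"
    and law: "\<And>i j. 1 \<le> j \<Longrightarrow> distr M (count_space UNIV) (W j (i + j)) = measure_pmf (Geom (r i j))"
    and r: "\<And>i j. 1 \<le> j \<Longrightarrow> 0 \<le> r i j \<and> r i j < 1"
  shows "prob {\<omega> \<in> space M. \<forall>i\<le>T. \<forall>j\<in>{1..h i}. W j (i + j) \<omega> = w i j} =
    (\<Prod>i\<le>T. \<Prod>j = 1..h i. r i j ^ w i j * (1 - r i j))"
proof -
  define K where "K = (SIGMA i:{..T}. {1..h i})"
  define J where "J = (\<lambda>(i, j). (j, i + j)) ` K"
  define B where "B = (\<lambda>(a, b). {w (b - a) a})"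
  have inj: "inj_on (\<lambda>(i, j). (j, i + j)) K" by (auto simp: inj_on_def)
  have K: "1 \<le> j" if "(i, j) \<in> K" for i j using that by (auto simp: K_def)
  have finite: "finite J" unfolding J_def K_def by auto
  have sub: "J \<subseteq> {(i, j). 1 \<le> i \<and> i \<le> j}" unfolding J_def using K by auto
  have event: "{\<omega> \<in> space M. \<forall>i\<le>T. \<forall>j\<in>{1..h i}. W j (i + j) \<omega> = w i j} =
      space M \<inter> (\<Inter>v\<in>J. (\<lambda>(i, j). W i j) v -` B v \<inter> space M)"
    unfolding J_def K_def B_def by auto
  have cell: "prob (W j (i + j) -` {v} \<inter> space M) = r i j ^ v * (1 - r i j)" if "1 \<le> j" for i j v
  proof -
    have "(j, i + j) \<in> {(i, j). 1 \<le> i \<and> i \<le> j}" using that by simp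
    then have "W j (i + j) \<in> measurable M (count_space UNIV)"
      using indep unfolding indep_vars_def by force
    then have "prob (W j (i + j) -` {v} \<inter> space M) = measure (distr M (count_space UNIV) (W j (i + j))) {v}"
      by (subst measure_distr) auto
    also have "\<dots> = pmf (Geom (r i j)) v" unfolding law[OF that] by (simp add: measure_pmf_single)
    finally show ?thesis using pmf_Geom r[OF that] by simp
  qed
  have "prob (space M \<inter> (\<Inter>v\<in>J. (\<lambda>(i, j). W i j) v -` B v \<inter> space M)) =
      (\<Prod>v\<in>J. prob ((\<lambda>(i, j). W i j) v -` B v \<inter> space M))"
  proof (cases "J = {}")
    case True
    then show ?thesis by (simp add: prob_space)
  next
    case False
    then have "space M \<inter> (\<Inter>v\<in>J. (\<lambda>(i, j). W i j) v -` B v \<inter> space M)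
        = (\<Inter>v\<in>J. (\<lambda>(i, j). W i j) v -` B v \<inter> space M)" by auto
    then show ?thesis using indep_varsD[OF indep False finite sub, of B] by simp
  qed
  also have "\<dots> = (\<Prod>(i, j)\<in>K. r i j ^ w i j * (1 - r i j))"
  proof -
    have "prob ((\<lambda>(i, j). W i j) (j, i + j) -` B (j, i + j) \<inter> space M) = r i j ^ w i j * (1 - r i j)"
      if "(i, j) \<in> K" for i j
      using cell[OF K[OF that]] by (simp add: B_def)
    then show ?thesis unfolding J_def prod.reindex[OF inj] by (intro prod.cong refl) auto
  qed
  also have "\<dots> = (\<Prod>i\<le>T. \<Prod>j = 1..h i. r i j ^ w i j * (1 - r i j))"
    unfolding K_def by (subst prod.Sigma) auto
  finally show ?thesis unfolding event .
qed

lemma is_partition_lpp_shape: "is_partition (lpp_shape A (m, n))"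
proof -
  have eq: "lpp_shape A (m, n) k = shape A m n (k - 1)" if "1 \<le> k" for k
    using lpp_shape_eq_shape[of A m n "k - 1"] that by simp
  have "0 \<le> lpp_shape A (m, n) k \<and> lpp_shape A (m, n) (k + 1) \<le> lpp_shape A (m, n) k" if "1 \<le> k" for k
    using shape_nonneg shape_antimono[of A m n "k - 1"] that by (simp add: eq)
  moreover have "lpp_shape A (m, n) k = 0" if "Suc (min m n) \<le> k" for k
    using shape_vanishes[of m n "k - 1" A] eq[of k] that by linarith
  ultimately show ?thesis unfolding is_partition_def by blast
qed

theorem theorem2p5:
  fixes P :: "'a measure"
    and W :: "nat \<Rightarrow> nat \<Rightarrow> 'a \<Rightarrow> nat"
    and x :: "nat \<Rightarrow> real" and c :: real
    and M N :: nat
    and \<gamma> :: "vertex list"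
    and \<Lambda> :: "nat \<Rightarrow> nat \<Rightarrow> int"
  assumes "prob_space P"
    and "\<And>i. i \<ge> 1 \<Longrightarrow> 0 \<le> x i"
    and "0 \<le> c"
    and "\<And>i j. i \<ge> 1 \<Longrightarrow> j \<ge> 1 \<Longrightarrow> x i * x j \<in> {0..<1}"
    and "\<And>i. i \<ge> 1 \<Longrightarrow> c * x i \<in> {0..<1}"
    and "\<And>i j \<omega>. i \<ge> 1 \<Longrightarrow> j \<ge> 1 \<Longrightarrow> \<omega> \<in> space P \<Longrightarrow> W i j \<omega> = W j i \<omega>"
    and "prob_space.indep_vars P (\<lambda>_. count_space UNIV) (\<lambda>(i, j). W i j)
           {(i, j). 1 \<le> i \<and> i \<le> j}"
    and "\<And>i j. i \<ge> 1 \<Longrightarrow> j \<ge> 1 \<Longrightarrow> i \<noteq> j \<Longrightarrow>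
           distr P (count_space UNIV) (W i j) = measure_pmf (Geom (x i * x j))"
    and "\<And>i. i \<ge> 1 \<Longrightarrow>
           distr P (count_space UNIV) (W i i) = measure_pmf (Geom (c * x i))"
    and "down_right_path \<gamma>"
    and "length \<gamma> = M + N + 1"
    and "\<gamma> ! 0 = (N, N)"
    and "\<gamma> ! (M + N) = (M + N, 0)"
    and "\<And>i. i \<le> M + N \<Longrightarrow> is_partition (\<Lambda> i)"
  shows "(\<forall>\<omega>\<in>space P. \<forall>m n. is_partition (lpp_shape (\<lambda>i j. W i j \<omega>) (m, n))) \<and>
    measure P {\<omega> \<in> space P. \<forall>i\<le>M + N. \<forall>k\<ge>1. lpp_shape (\<lambda>i j. W i j \<omega>) (\<gamma> ! i) k = \<Lambda> i k} =
      norm_const x c N \<gamma> * tau (\<Lambda> 0) c *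
      (if \<forall>k\<ge>1. \<Lambda> (M + N) k = 0 then 1 else 0) *
      (\<Prod>i = 1..M + N. Q_weight x (\<gamma> ! (i - 1)) (path_word \<gamma> ! (i - 1)) (\<Lambda> (i - 1)) (\<Lambda> i))"
proof (intro conjI ballI allI is_partition_lpp_shape)
  interpret prob_space P by (rule assms(1))
  define T where "T = M + N"
  define h where "h i = snd (\<gamma> ! i)" for i
  define \<Lambda>' where "\<Lambda>' i k = \<Lambda> i (Suc k)" for i k
  note path = assms(10) assms(11)[folded T_def] assms(12) assms(13)[folded T_def]
  have vertex: "\<gamma> ! i = (i + h i, h i)" if "i \<le> T" for i
    using down_right_path_heights(1)[OF path that] by (simp add: h_def)
  have stairs: "staircase T h"
    using down_right_path_heights(2)[OF path] unfolding h_def[abs_def] .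
  have letter: "path_word \<gamma> ! i = (if h (Suc i) = h i then StepR else StepD)" if "i < T" for i
    using down_right_path_heights(3)[OF path that] by (simp add: h_def)
  have shift: "(\<forall>k\<ge>1. R k) \<longleftrightarrow> (\<forall>k. R (Suc k))" for R :: "nat \<Rightarrow> bool"
    by (metis One_nat_def Suc_le_D Suc_le_mono le0)
  have parts: "part (\<Lambda>' i)" if "i \<le> T" for i
  proof -
    have i: "\<forall>k\<ge>1. 0 \<le> \<Lambda> i k \<and> \<Lambda> i (k + 1) \<le> \<Lambda> i k" and "\<exists>K. \<forall>k\<ge>K. \<Lambda> i k = 0"
      using assms(14)[of i] that unfolding is_partition_def T_def by blast+
    then obtain K where "\<forall>k\<ge>K. \<Lambda> i k = 0" by blast
    then have "\<forall>k\<ge>K. \<Lambda>' i k = 0" by (simp add: \<Lambda>'_def)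
    moreover have "\<forall>k. 0 \<le> \<Lambda>' i k \<and> \<Lambda>' i (Suc k) \<le> \<Lambda>' i k"
      using i unfolding shift by (simp add: \<Lambda>'_def)
    ultimately show ?thesis unfolding part_def by blast
  qed
  have symm: "symm (\<lambda>i j. W i j \<omega>)" if "\<omega> \<in> space P" for \<omega>
    using assms(6) that by (simp add: symm_def)
  have event: "{\<omega> \<in> space P. \<forall>i\<le>M + N. \<forall>k\<ge>1. lpp_shape (\<lambda>i j. W i j \<omega>) (\<gamma> ! i) k = \<Lambda> i k} =
      {\<omega> \<in> space P. fits (\<lambda>i j. W i j \<omega>) T h \<Lambda>'}"
  proof -
    have "(\<forall>k\<ge>1. lpp_shape A (\<gamma> ! i) k = \<Lambda> i k) \<longleftrightarrow> shape A (i + h i) (h i) = \<Lambda>' i"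
      if "i \<le> T" for A i
      unfolding shift vertex[OF that] lpp_shape_eq_shape fun_eq_iff \<Lambda>'_def ..
    then show ?thesis unfolding fits_def T_def[symmetric] by blast
  qed
  have weight: "tau (\<Lambda> 0) c * (if \<forall>k\<ge>1. \<Lambda> (M + N) k = 0 then 1 else 0) *
      (\<Prod>i = 1..M + N. Q_weight x (\<gamma> ! (i - 1)) (path_word \<gamma> ! (i - 1)) (\<Lambda> (i - 1)) (\<Lambda> i))
      = staircase_weight x c T h \<Lambda>'"
  proof -
    have "Q_weight x (\<gamma> ! i) (path_word \<gamma> ! i) (\<Lambda> i) (\<Lambda> (Suc i)) = step_weight x h \<Lambda>' i"
      if "i < T" for i
      using vertex[of i] that unfolding letter[OF that]
      by (simp add: Q_weight_def step_weight_def skew_schur_eq_skew \<Lambda>'_def[abs_def])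
    then have "(\<Prod>i = 1..T. Q_weight x (\<gamma> ! (i - 1)) (path_word \<gamma> ! (i - 1)) (\<Lambda> (i - 1)) (\<Lambda> i))
        = (\<Prod>i<T. step_weight x h \<Lambda>' i)"
      unfolding One_nat_def prod.atLeast1_atMost_eq[unfolded One_nat_def]
      by (intro prod.cong refl) simp
    moreover have "(\<forall>k\<ge>1. \<Lambda> T k = 0) \<longleftrightarrow> \<Lambda>' T = (\<lambda>_. 0)"
      unfolding shift fun_eq_iff \<Lambda>'_def ..
    moreover have "tau (\<Lambda> 0) c = alternating (\<Lambda>' 0) c"
      unfolding tau_eq_alternating by (simp add: \<Lambda>'_def[abs_def])
    ultimately show ?thesis unfolding staircase_weight_def T_def[symmetric] by simp
  qed
  have "h 0 = N" using assms(12) by (simp add: h_def)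
  then have norm: "norm_const x c N \<gamma> = (\<Prod>i\<le>T. \<Prod>j = 1..h i. 1 - rate x c i j)"
    using norm_const_heights[of \<gamma> T h x c] path(2) vertex by simp
  have "(\<exists>w. encodes x c T h \<Lambda>' w) \<or>
      ((\<forall>A. symm A \<longrightarrow> \<not> fits A T h \<Lambda>') \<and> staircase_weight x c T h \<Lambda>' = 0)"
    by (rule staircase_bijection[OF stairs]) (rule parts)
  then have "prob {\<omega> \<in> space P. fits (\<lambda>i j. W i j \<omega>) T h \<Lambda>'} = norm_const x c N \<gamma> * staircase_weight x c T h \<Lambda>'"
  proof (elim disjE exE conjE)
    fix w assume w: "encodes x c T h \<Lambda>' w"
    have "fits (\<lambda>i j. W i j \<omega>) T h \<Lambda>' \<longleftrightarrow> (\<forall>i\<le>T. \<forall>j\<in>{1..h i}. W j (i + j) \<omega> = w i j)"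
      if "\<omega> \<in> space P" for \<omega>
    proof -
      have "(W (i + j) j \<omega> = w i j) \<longleftrightarrow> (W j (i + j) \<omega> = w i j)" if "j \<in> {1..h i}" for i j
        using that \<open>\<omega> \<in> space P\<close> assms(6)[of "i + j" j \<omega>] by simp
      then have "(\<forall>i\<le>T. \<forall>j\<in>{1..h i}. W (i + j) j \<omega> = w i j) \<longleftrightarrow>
          (\<forall>i\<le>T. \<forall>j\<in>{1..h i}. W j (i + j) \<omega> = w i j)" by blast
      moreover have "fits (\<lambda>i j. W i j \<omega>) T h \<Lambda>' \<longleftrightarrow> (\<forall>i\<le>T. \<forall>j\<in>{1..h i}. W (i + j) j \<omega> = w i j)"
        by (rule w[unfolded encodes_def, THEN conjunct1, rule_format, OF symm[OF that]])
      ultimately show ?thesis by simp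
    qed
    then have same: "{\<omega> \<in> space P. fits (\<lambda>i j. W i j \<omega>) T h \<Lambda>'} =
        {\<omega> \<in> space P. \<forall>i\<le>T. \<forall>j\<in>{1..h i}. W j (i + j) \<omega> = w i j}"
      by (intro Collect_cong conj_cong refl)
    have "prob {\<omega> \<in> space P. \<forall>i\<le>T. \<forall>j\<in>{1..h i}. W j (i + j) \<omega> = w i j} =
        (\<Prod>i\<le>T. \<Prod>j = 1..h i. rate x c i j ^ w i j * (1 - rate x c i j))"
    proof (rule geometric_cells[OF assms(7)])
      fix i j :: nat assume j: "1 \<le> j"
      show "distr P (count_space UNIV) (W j (i + j)) = measure_pmf (Geom (rate x c i j))"
      proof (cases "i = 0")
        case True
        then show ?thesis using assms(9)[OF j] by (simp add: rate_def)
      next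
        case False
        then show ?thesis using assms(8)[of j "i + j"] j by (simp add: rate_def mult.commute[of "x j"])
      qed
      show "0 \<le> rate x c i j \<and> rate x c i j < 1"
        using assms(4)[of "i + j" j] assms(5)[of j] j by (auto simp: rate_def)
    qed
    also have "\<dots> = norm_const x c N \<gamma> * staircase_weight x c T h \<Lambda>'"
      unfolding norm w[unfolded encodes_def, THEN conjunct2] by (simp only: prod.distrib mult.commute)
    finally show ?thesis unfolding same .
  next
    assume none: "\<forall>A. symm A \<longrightarrow> \<not> fits A T h \<Lambda>'" and zero: "staircase_weight x c T h \<Lambda>' = 0"
    have none': "{\<omega> \<in> space P. fits (\<lambda>i j. W i j \<omega>) T h \<Lambda>'} = {}" using none symm by auto
    show ?thesis unfolding none' zero by simp
  qed
  then show "measure P {\<omega> \<in> space P. \<forall>i\<le>M + N. \<forall>k\<ge>1. lpp_shape (\<lambda>i j. W i j \<omega>) (\<gamma> ! i) k = \<Lambda> i k} =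
      norm_const x c N \<gamma> * tau (\<Lambda> 0) c *
      (if \<forall>k\<ge>1. \<Lambda> (M + N) k = 0 then 1 else 0) *
      (\<Prod>i = 1..M + N. Q_weight x (\<gamma> ! (i - 1)) (path_word \<gamma> ! (i - 1)) (\<Lambda> (i - 1)) (\<Lambda> i))"
    unfolding event weight[symmetric] by (simp only: mult.assoc)
qed

end
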